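(* Let $\lambda\geq\kappa$ be infinite cardinals with $\lambda$ regular, let $\mathcal A$ be a $\lambda$-mono-generated category, let $T$ be a basic universal theory belonging to the class $\forall_{\lambda\kappa}$, and let $F:\mathcal A\to\mathrm{Mod}(T)$ be a functor that takes $\lambda$-directed colimits of monomorphisms to colimits. If $X,Y$ are objects of $\mathcal A$ with $X\sim_\lambda Y$ in $\mathcal A$, then $F(X)\sim_\lambda F(Y)$ in $\mathrm{Mod}(T)$.
   Context: A $\lambda$-directed diagram is a functor whose domain is a $\lambda$-directed poset (every subset of cardinality $<\lambda$ has an upper bound); a $\lambda$-directed colimit of monomorphisms is a colimit of a $\lambda$-directed diagram all of whose maps are monomorphisms. "$F$ takes $\lambda$-directed colimits of monomorphisms to colimits" means that $F$ sends the colimit cocone of any such diagram (whose colimit exists in $\mathcal A$) to a colimit cocone; $F$ need not preserve monomorphisms. An object $G$ of a category $\mathcal A$ is $\lambda$-generated if $\hom(G,-):\mathcal A\to \mathrm{Set}$ preserves those $\lambda$-directed colimits of monomorphisms that exist in $\mathcal A$. The category $\mathcal A$ is $\lambda$-mono-generated if every object of $\mathcal A$ is a colimit of a $\lambda$-directed diagram consisting of monomorphisms and $\lambda$-generated objects. (It is not assumed that all $\lambda$-directed colimits of monomorphisms exist.) A span between objects $X,Y$ is a diagram $X\xleftarrow{x}U\xrightarrow{y}Y$ with both $x,y$ monomorphisms. A set $\{X\xleftarrow{x_i}U_i\xrightarrow{y_i}Y \mid i\in I\}$ of spans is $\lambda$-dense if it is non-empty and: (back) for all $i\in I$ and every monomorphism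 $g:G\to X$ with $G$ $\lambda$-generated, there exist $j\in I$ and morphisms $s:G\to U_j$, $w:U_i\to U_j$ with $x_js=g$, $x_jw=x_i$, $y_jw=y_i$; (forth) for all $i\in I$ and every monomorphism $g:G\to Y$ with $G$ $\lambda$-generated, there exist $j\in I$ and morphisms $s:G\to U_j$, $w:U_i\to U_j$ with $y_js=g$, $x_jw=x_i$, $y_jw=y_i$. Objects $X,Y$ are $\lambda$-equivalent, written $X\sim_\lambda Y$, if there exists a $\lambda$-dense set of spans between $X$ and $Y$. Let $\Sigma$ be a language for $L_{\infty\kappa}$: possibly many-sorted, with relation and function symbols (including constants) of arity less than $\kappa$. Homomorphisms of $\Sigma$-structures are maps preserving the interpretations of function symbols and preserving (not necessarily reflecting) the relations. A basic universal theory in $L_{\infty\kappa}$ is one axiomatized by a set of sentences (no free variables) of the form $\forall\mathbf x(\phi\Rightarrow\psi)$, where $\mathbf x$ is a tuple of fewer than $\kappa$ variables and $\phi,\psi$ are built from atomic formulas (including equations) using arbitrary set-indexed conjunctions $\bigwedge$ and disjunctions $\bigvee$ only (the empty conjunction being $\top$ and the empty disjunction $\bot$). $\forall_{\lambda\kappa}$ is the class of basic universal theories in $L_{\infty\kappa}$ in which conjunctions $\bigwedge_{i\in I}$ are used only with $|I|<\lambda$ (disjunctions are unrestricted). $\mathrm{Mod}(T)$ is the category of models of $T$ and homomorphisms of $\Sigma$-structures. *)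

theory Defs
  imports Main "HOL-Library.FuncSet"
begin

unbundle cardinal_syntax

text \<open>
  Size conventions.  HOL has no type of all sets, so ``set'' (as opposed to ``class'') is made
  relative to a regular cardinal \<open>\<theta> :: 'u rel\<close>: a collection is a set if it has fewer than
  \<open>\<theta>\<close> elements.  The sets over which diagrams, structures, arities, variables and connectives are
  indexed are subsets of the type \<open>'u\<close>, which has at least \<open>\<theta>\<close> elements and hence contains a
  copy of each set.  If \<open>\<theta>\<close> is inaccessible, these are the sets of a Grothendieck universe.

  The cardinal usually called lambda is named \<open>lam\<close>, the Greek letter being the HOL binder.
\<close>

definition small :: "'u rel \<Rightarrow> 'a set \<Rightarrow> bool" where
  "small \<theta> A \<longleftrightarrow> |A| <o \<theta>"


section \<open>Categories, functors and colimits\<close>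

record ('o, 'm) cat =
  Ob  :: "'o set"
  Ar  :: "'m set"
  Dom :: "'m \<Rightarrow> 'o"
  Cod :: "'m \<Rightarrow> 'o"
  Idn :: "'o \<Rightarrow> 'm"
  Cmp :: "'m \<Rightarrow> 'm \<Rightarrow> 'm"  \<comment> \<open>\<open>Cmp C g f\<close> is \<open>g\<close> after \<open>f\<close>\<close>

definition hom :: "('o, 'm) cat \<Rightarrow> 'o \<Rightarrow> 'o \<Rightarrow> 'm set" where
  "hom C a b = {f \<in> Ar C. Dom C f = a \<and> Cod C f = b}"

locale category =
  fixes C :: "('o, 'm) cat"
  assumes dom_cod: "f \<in> Ar C \<Longrightarrow> Dom C f \<in> Ob C \<and> Cod C f \<in> Ob C"
    and idn: "a \<in> Ob C \<Longrightarrow> Idn C a \<in> hom C a a"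
    and cmp: "f \<in> hom C a b \<Longrightarrow> g \<in> hom C b c \<Longrightarrow> Cmp C g f \<in> hom C a c"
    and idn_left: "f \<in> hom C a b \<Longrightarrow> Cmp C (Idn C b) f = f"
    and idn_right: "f \<in> hom C a b \<Longrightarrow> Cmp C f (Idn C a) = f"
    and assoc: "f \<in> hom C a b \<Longrightarrow> g \<in> hom C b c \<Longrightarrow> h \<in> hom C c d \<Longrightarrow>
      Cmp C h (Cmp C g f) = Cmp C (Cmp C h g) f"

definition mono_in :: "('o, 'm) cat \<Rightarrow> 'm \<Rightarrow> bool" where
  "mono_in C f \<longleftrightarrow> f \<in> Ar C \<and>
    (\<forall>Z\<in>Ob C. \<forall>g\<in>hom C Z (Dom C f). \<forall>h\<in>hom C Z (Dom C f). Cmp C f g = Cmp C f h \<longrightarrow> g = h)"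

record ('o, 'm, 'p, 'n) fctr =
  obj :: "'o \<Rightarrow> 'p"
  arr :: "'m \<Rightarrow> 'n"

definition is_functor :: "('o, 'm) cat \<Rightarrow> ('p, 'n) cat \<Rightarrow> ('o, 'm, 'p, 'n) fctr \<Rightarrow> bool" where
  "is_functor C D F \<longleftrightarrow>
    (\<forall>a\<in>Ob C. obj F a \<in> Ob D) \<and>
    (\<forall>f\<in>Ar C. arr F f \<in> hom D (obj F (Dom C f)) (obj F (Cod C f))) \<and>
    (\<forall>a\<in>Ob C. arr F (Idn C a) = Idn D (obj F a)) \<and>
    (\<forall>a\<in>Ob C. \<forall>b\<in>Ob C. \<forall>c\<in>Ob C. \<forall>f\<in>hom C a b. \<forall>g\<in>hom C b c.
      arr F (Cmp C g f) = Cmp D (arr F g) (arr F f))"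

definition fcomp :: "('p, 'n, 'q, 'k) fctr \<Rightarrow> ('o, 'm, 'p, 'n) fctr \<Rightarrow> ('o, 'm, 'q, 'k) fctr" where
  "fcomp G F = \<lparr>obj = obj G \<circ> obj F, arr = arr G \<circ> arr F\<rparr>"

definition cocone ::
  "('i, 'j) cat \<Rightarrow> ('o, 'm) cat \<Rightarrow> ('i, 'j, 'o, 'm) fctr \<Rightarrow> 'o \<Rightarrow> ('i \<Rightarrow> 'm) \<Rightarrow> bool" where
  "cocone J C D X c \<longleftrightarrow> X \<in> Ob C \<and> (\<forall>i\<in>Ob J. c i \<in> hom C (obj D i) X) \<and>
    (\<forall>u\<in>Ar J. Cmp C (c (Cod J u)) (arr D u) = c (Dom J u))"

definition colimit_cocone ::
  "('i, 'j) cat \<Rightarrow> ('o, 'm) cat \<Rightarrow> ('i, 'j, 'o, 'm) fctr \<Rightarrow> 'o \<Rightarrow> ('i \<Rightarrow> 'm) \<Rightarrow> bool" where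
  "colimit_cocone J C D X c \<longleftrightarrow> cocone J C D X c \<and>
    (\<forall>Y d. cocone J C D Y d \<longrightarrow> (\<exists>!h. h \<in> hom C X Y \<and> (\<forall>i\<in>Ob J. Cmp C h (c i) = d i)))"


section \<open>\<open>lam\<close>-directed diagrams of monomorphisms\<close>

definition directed_poset :: "'l rel \<Rightarrow> 'u set \<Rightarrow> 'u rel \<Rightarrow> bool" where
  "directed_poset lam P r \<longleftrightarrow> partial_order_on P r \<and>
    (\<forall>S. S \<subseteq> P \<and> |S| <o lam \<longrightarrow> (\<exists>d\<in>P. \<forall>s\<in>S. (s, d) \<in> r))"

definition poset_cat :: "'u set \<Rightarrow> 'u rel \<Rightarrow> ('u, 'u \<times> 'u) cat" where
  "poset_cat P r = \<lparr>Ob = P, Ar = r, Dom = fst, Cod = snd,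
    Idn = (\<lambda>a. (a, a)), Cmp = (\<lambda>g f. (fst f, snd g))\<rparr>"

definition directed_mono_diagram ::
  "'u rel \<Rightarrow> 'l rel \<Rightarrow> ('o, 'm) cat \<Rightarrow> 'u set \<Rightarrow> 'u rel \<Rightarrow> ('u, 'u \<times> 'u, 'o, 'm) fctr \<Rightarrow> bool" where
  "directed_mono_diagram \<theta> lam C P r D \<longleftrightarrow>
    small \<theta> P \<and> directed_poset lam P r \<and> is_functor (poset_cat P r) C D \<and>
    (\<forall>u\<in>r. mono_in C (arr D u))"

definition directed_mono_colims_to_colims ::
  "'u rel \<Rightarrow> 'l rel \<Rightarrow> ('o, 'm) cat \<Rightarrow> ('p, 'n) cat \<Rightarrow> ('o, 'm, 'p, 'n) fctr \<Rightarrow> bool" where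
  "directed_mono_colims_to_colims \<theta> lam C D F \<longleftrightarrow>
    (\<forall>P r G X c. directed_mono_diagram \<theta> lam C P r G \<and> colimit_cocone (poset_cat P r) C G X c \<longrightarrow>
      colimit_cocone (poset_cat P r) D (fcomp F G) (obj F X) (\<lambda>i. arr F (c i)))"


section \<open>Hom functors and \<open>lam\<close>-generated objects\<close>

definition set_cat :: "('x set, 'x set \<times> ('x \<Rightarrow> 'x) \<times> 'x set) cat" where
  "set_cat = \<lparr>Ob = UNIV, Ar = {(A, f, B). f \<in> A \<rightarrow>\<^sub>E B},
    Dom = (\<lambda>(A, f, B). A), Cod = (\<lambda>(A, f, B). B),
    Idn = (\<lambda>A. (A, restrict id A, A)),
    Cmp = (\<lambda>(B', g, C) (A, f, B). (A, compose A g f, C))\<rparr>"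

text \<open>
  The hom functor takes values in the category of subsets of \<open>'u + 'm\<close>, so that its codomain
  contains the quotients of small (indexed by subsets of \<open>'u\<close>) disjoint unions of hom-sets also
  when \<open>'m\<close> itself has few elements.  No bound is put on the size of the hom-sets.
\<close>

definition hom_functor ::
  "('o, 'm) cat \<Rightarrow> 'o \<Rightarrow>
    ('o, 'm, ('u + 'm) set, ('u + 'm) set \<times> ('u + 'm \<Rightarrow> 'u + 'm) \<times> ('u + 'm) set) fctr" where
  "hom_functor C G =
    \<lparr>obj = (\<lambda>X. Inr ` hom C G X),
     arr = (\<lambda>f. (Inr ` hom C G (Dom C f),
                 \<lambda>x \<in> Inr ` hom C G (Dom C f). Inr (Cmp C f (projr x)),
                 Inr ` hom C G (Cod C f)))\<rparr>"

definition generated :: "'u rel \<Rightarrow> 'l rel \<Rightarrow> ('o, 'm) cat \<Rightarrow> 'o \<Rightarrow> bool" where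
  "generated \<theta> lam C G \<longleftrightarrow> G \<in> Ob C \<and>
    directed_mono_colims_to_colims \<theta> lam C set_cat
      (hom_functor C G ::
        ('o, 'm, ('u + 'm) set, ('u + 'm) set \<times> ('u + 'm \<Rightarrow> 'u + 'm) \<times> ('u + 'm) set) fctr)"

definition mono_generated :: "'u rel \<Rightarrow> 'l rel \<Rightarrow> ('o, 'm) cat \<Rightarrow> bool" where
  "mono_generated \<theta> lam C \<longleftrightarrow> category C \<and>
    (\<forall>X\<in>Ob C. \<exists>P r G c. directed_mono_diagram \<theta> lam C P r G \<and>
      (\<forall>i\<in>P. generated \<theta> lam C (obj G i)) \<and> colimit_cocone (poset_cat P r) C G X c)"


section \<open>\<open>lam\<close>-equivalence\<close>

definition is_span :: "('o, 'm) cat \<Rightarrow> 'o \<Rightarrow> 'o \<Rightarrow> 'o \<times> 'm \<times> 'm \<Rightarrow> bool" where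
  "is_span C X Y = (\<lambda>(U, x, y).
    x \<in> hom C U X \<and> y \<in> hom C U Y \<and> mono_in C x \<and> mono_in C y)"

definition dense_spans ::
  "'u rel \<Rightarrow> 'l rel \<Rightarrow> ('o, 'm) cat \<Rightarrow> 'o \<Rightarrow> 'o \<Rightarrow> ('o \<times> 'm \<times> 'm) set \<Rightarrow> bool" where
  "dense_spans \<theta> lam C X Y S \<longleftrightarrow> small \<theta> S \<and> (\<forall>p\<in>S. is_span C X Y p) \<and> S \<noteq> {} \<and>
    (\<forall>(U, x, y)\<in>S. \<forall>G g. generated \<theta> lam C G \<and> g \<in> hom C G X \<and> mono_in C g \<longrightarrow>
      (\<exists>(V, x', y')\<in>S. \<exists>s\<in>hom C G V. \<exists>w\<in>hom C U V.
        Cmp C x' s = g \<and> Cmp C x' w = x \<and> Cmp C y' w = y)) \<and>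
    (\<forall>(U, x, y)\<in>S. \<forall>G g. generated \<theta> lam C G \<and> g \<in> hom C G Y \<and> mono_in C g \<longrightarrow>
      (\<exists>(V, x', y')\<in>S. \<exists>s\<in>hom C G V. \<exists>w\<in>hom C U V.
        Cmp C y' s = g \<and> Cmp C x' w = x \<and> Cmp C y' w = y))"

definition lam_equivalent :: "'u rel \<Rightarrow> 'l rel \<Rightarrow> ('o, 'm) cat \<Rightarrow> 'o \<Rightarrow> 'o \<Rightarrow> bool" where
  "lam_equivalent \<theta> lam C X Y \<longleftrightarrow> X \<in> Ob C \<and> Y \<in> Ob C \<and> (\<exists>S. dense_spans \<theta> lam C X Y S)"


section \<open>Languages, structures and basic universal theories\<close>

text \<open>
  An arity is a set of argument positions (a subset of \<open>'u\<close>) together with a sort for each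
  position.  A constant is a function symbol with no argument positions.
\<close>

record ('s, 'f, 'r, 'u) lang =
  sorts :: "'s set"
  funs  :: "'f set"
  rels  :: "'r set"
  fargs :: "'f \<Rightarrow> 'u set"
  fsort :: "'f \<Rightarrow> 'u \<Rightarrow> 's"
  fres  :: "'f \<Rightarrow> 's"
  rargs :: "'r \<Rightarrow> 'u set"
  rsort :: "'r \<Rightarrow> 'u \<Rightarrow> 's"

definition language :: "'u rel \<Rightarrow> 'k rel \<Rightarrow> ('s, 'f, 'r, 'u) lang \<Rightarrow> bool" where
  "language \<theta> \<kappa> \<Sigma> \<longleftrightarrow> small \<theta> (sorts \<Sigma>) \<and> small \<theta> (funs \<Sigma>) \<and> small \<theta> (rels \<Sigma>) \<and>
    (\<forall>f\<in>funs \<Sigma>. |fargs \<Sigma> f| <o \<kappa> \<and> fsort \<Sigma> f ` fargs \<Sigma> f \<subseteq> sorts \<Sigma> \<and> fres \<Sigma> f \<in> sorts \<Sigma>) \<and>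
    (\<forall>R\<in>rels \<Sigma>. |rargs \<Sigma> R| <o \<kappa> \<and> rsort \<Sigma> R ` rargs \<Sigma> R \<subseteq> sorts \<Sigma>)"

record ('s, 'f, 'r, 'u) struct =
  carr :: "'s \<Rightarrow> 'u set"
  fint :: "'f \<Rightarrow> ('u \<Rightarrow> 'u) \<Rightarrow> 'u"
  rint :: "'r \<Rightarrow> ('u \<Rightarrow> 'u) set"

definition fun_tuples :: "('s, 'f, 'r, 'u) lang \<Rightarrow> ('s, 'f, 'r, 'u) struct \<Rightarrow> 'f \<Rightarrow> ('u \<Rightarrow> 'u) set" where
  "fun_tuples \<Sigma> M f = (\<Pi>\<^sub>E p\<in>fargs \<Sigma> f. carr M (fsort \<Sigma> f p))"

definition rel_tuples :: "('s, 'f, 'r, 'u) lang \<Rightarrow> ('s, 'f, 'r, 'u) struct \<Rightarrow> 'r \<Rightarrow> ('u \<Rightarrow> 'u) set" where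
  "rel_tuples \<Sigma> M R = (\<Pi>\<^sub>E p\<in>rargs \<Sigma> R. carr M (rsort \<Sigma> R p))"

definition structure_of :: "'u rel \<Rightarrow> ('s, 'f, 'r, 'u) lang \<Rightarrow> ('s, 'f, 'r, 'u) struct \<Rightarrow> bool" where
  "structure_of \<theta> \<Sigma> M \<longleftrightarrow> (\<forall>s\<in>sorts \<Sigma>. small \<theta> (carr M s)) \<and>
    (\<forall>f\<in>funs \<Sigma>. fint M f \<in> fun_tuples \<Sigma> M f \<rightarrow>\<^sub>E carr M (fres \<Sigma> f)) \<and>
    (\<forall>R\<in>rels \<Sigma>. rint M R \<subseteq> rel_tuples \<Sigma> M R)"

definition homomorphism ::
  "('s, 'f, 'r, 'u) lang \<Rightarrow> ('s, 'f, 'r, 'u) struct \<Rightarrow> ('s, 'f, 'r, 'u) struct \<Rightarrow>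
    ('s \<Rightarrow> 'u \<Rightarrow> 'u) \<Rightarrow> bool" where
  "homomorphism \<Sigma> M N h \<longleftrightarrow>
    h \<in> (\<Pi>\<^sub>E s\<in>sorts \<Sigma>. carr M s \<rightarrow>\<^sub>E carr N s) \<and>
    (\<forall>f\<in>funs \<Sigma>. \<forall>a\<in>fun_tuples \<Sigma> M f.
      h (fres \<Sigma> f) (fint M f a) = fint N f (\<lambda>p\<in>fargs \<Sigma> f. h (fsort \<Sigma> f p) (a p))) \<and>
    (\<forall>R\<in>rels \<Sigma>. \<forall>a\<in>rint M R. (\<lambda>p\<in>rargs \<Sigma> R. h (rsort \<Sigma> R p) (a p)) \<in> rint N R)"

text \<open>
  Variables and indices of connectives are elements of \<open>'u\<close>.  In \<open>Fn f t\<close> and \<open>Rel R t\<close> only the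
  values of \<open>t\<close> on argument positions matter, in \<open>Conj I \<phi>\<close> and \<open>Disj I \<phi>\<close> only those of \<open>\<phi>\<close> on \<open>I\<close>.
\<close>

datatype ('f, 'u) tm = Var 'u | Fn 'f "'u \<Rightarrow> ('f, 'u) tm"

datatype ('f, 'r, 'u) form =
    Eq "('f, 'u) tm" "('f, 'u) tm"
  | Rel 'r "'u \<Rightarrow> ('f, 'u) tm"
  | Conj "'u set" "'u \<Rightarrow> ('f, 'r, 'u) form"
  | Disj "'u set" "'u \<Rightarrow> ('f, 'r, 'u) form"

text \<open>
  Well-formedness is relative to a set \<open>X\<close> of variables with sorts \<open>\<Gamma>\<close>.  The cardinal \<open>lam\<close> bounds the
  conjunctions; disjunctions are indexed by arbitrary sets.
\<close>

inductive has_sort ::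
  "('s, 'f, 'r, 'u) lang \<Rightarrow> 'u set \<Rightarrow> ('u \<Rightarrow> 's) \<Rightarrow> ('f, 'u) tm \<Rightarrow> 's \<Rightarrow> bool"
  for \<Sigma> X \<Gamma> where
    "x \<in> X \<Longrightarrow> has_sort \<Sigma> X \<Gamma> (Var x) (\<Gamma> x)"
  | "f \<in> funs \<Sigma> \<Longrightarrow> (\<And>p. p \<in> fargs \<Sigma> f \<Longrightarrow> has_sort \<Sigma> X \<Gamma> (t p) (fsort \<Sigma> f p)) \<Longrightarrow>
      has_sort \<Sigma> X \<Gamma> (Fn f t) (fres \<Sigma> f)"

inductive wf_form ::
  "'u rel \<Rightarrow> 'l rel \<Rightarrow> ('s, 'f, 'r, 'u) lang \<Rightarrow> 'u set \<Rightarrow> ('u \<Rightarrow> 's) \<Rightarrow> ('f, 'r, 'u) form \<Rightarrow> bool"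
  for \<theta> lam \<Sigma> X \<Gamma> where
    "has_sort \<Sigma> X \<Gamma> t s \<Longrightarrow> has_sort \<Sigma> X \<Gamma> t' s \<Longrightarrow> wf_form \<theta> lam \<Sigma> X \<Gamma> (Eq t t')"
  | "R \<in> rels \<Sigma> \<Longrightarrow> (\<And>p. p \<in> rargs \<Sigma> R \<Longrightarrow> has_sort \<Sigma> X \<Gamma> (t p) (rsort \<Sigma> R p)) \<Longrightarrow>
      wf_form \<theta> lam \<Sigma> X \<Gamma> (Rel R t)"
  | "|I| <o lam \<Longrightarrow> (\<And>i. i \<in> I \<Longrightarrow> wf_form \<theta> lam \<Sigma> X \<Gamma> (\<phi> i)) \<Longrightarrow> wf_form \<theta> lam \<Sigma> X \<Gamma> (Conj I \<phi>)"
  | "small \<theta> I \<Longrightarrow> (\<And>i. i \<in> I \<Longrightarrow> wf_form \<theta> lam \<Sigma> X \<Gamma> (\<phi> i)) \<Longrightarrow> wf_form \<theta> lam \<Sigma> X \<Gamma> (Disj I \<phi>)"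

primrec eval ::
  "('s, 'f, 'r, 'u) lang \<Rightarrow> ('s, 'f, 'r, 'u) struct \<Rightarrow> ('u \<Rightarrow> 'u) \<Rightarrow> ('f, 'u) tm \<Rightarrow> 'u" where
  "eval \<Sigma> M v (Var x) = v x"
| "eval \<Sigma> M v (Fn f t) = fint M f (\<lambda>p\<in>fargs \<Sigma> f. eval \<Sigma> M v (t p))"

primrec sat ::
  "('s, 'f, 'r, 'u) lang \<Rightarrow> ('s, 'f, 'r, 'u) struct \<Rightarrow> ('u \<Rightarrow> 'u) \<Rightarrow> ('f, 'r, 'u) form \<Rightarrow> bool" where
  "sat \<Sigma> M v (Eq t t') \<longleftrightarrow> eval \<Sigma> M v t = eval \<Sigma> M v t'"
| "sat \<Sigma> M v (Rel R t) \<longleftrightarrow> (\<lambda>p\<in>rargs \<Sigma> R. eval \<Sigma> M v (t p)) \<in> rint M R"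
| "sat \<Sigma> M v (Conj I \<phi>) \<longleftrightarrow> (\<forall>i\<in>I. sat \<Sigma> M v (\<phi> i))"
| "sat \<Sigma> M v (Disj I \<phi>) \<longleftrightarrow> (\<exists>i\<in>I. sat \<Sigma> M v (\<phi> i))"

text \<open>\<open>All_Imp X \<Gamma> \<phi> \<psi>\<close> is the sentence \<open>\<forall>x (\<phi> \<Rightarrow> \<psi>)\<close>, where \<open>x\<close> lists the variables in \<open>X\<close>.\<close>

datatype ('s, 'f, 'r, 'u) sentence =
  All_Imp "'u set" "'u \<Rightarrow> 's" "('f, 'r, 'u) form" "('f, 'r, 'u) form"

fun wf_sentence ::
  "'u rel \<Rightarrow> 'l rel \<Rightarrow> 'k rel \<Rightarrow> ('s, 'f, 'r, 'u) lang \<Rightarrow> ('s, 'f, 'r, 'u) sentence \<Rightarrow> bool" where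
  "wf_sentence \<theta> lam \<kappa> \<Sigma> (All_Imp X \<Gamma> \<phi> \<psi>) \<longleftrightarrow>
    |X| <o \<kappa> \<and> \<Gamma> ` X \<subseteq> sorts \<Sigma> \<and> wf_form \<theta> lam \<Sigma> X \<Gamma> \<phi> \<and> wf_form \<theta> lam \<Sigma> X \<Gamma> \<psi>"

fun holds ::
  "('s, 'f, 'r, 'u) lang \<Rightarrow> ('s, 'f, 'r, 'u) struct \<Rightarrow> ('s, 'f, 'r, 'u) sentence \<Rightarrow> bool" where
  "holds \<Sigma> M (All_Imp X \<Gamma> \<phi> \<psi>) \<longleftrightarrow>
    (\<forall>v \<in> (\<Pi>\<^sub>E x\<in>X. carr M (\<Gamma> x)). sat \<Sigma> M v \<phi> \<longrightarrow> sat \<Sigma> M v \<psi>)"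

definition basic_universal_theory ::
  "'u rel \<Rightarrow> 'l rel \<Rightarrow> 'k rel \<Rightarrow> ('s, 'f, 'r, 'u) lang \<Rightarrow> ('s, 'f, 'r, 'u) sentence set \<Rightarrow> bool" where
  "basic_universal_theory \<theta> lam \<kappa> \<Sigma> T \<longleftrightarrow> small \<theta> T \<and> (\<forall>\<sigma>\<in>T. wf_sentence \<theta> lam \<kappa> \<Sigma> \<sigma>)"

definition Mod ::
  "'u rel \<Rightarrow> ('s, 'f, 'r, 'u) lang \<Rightarrow> ('s, 'f, 'r, 'u) sentence set \<Rightarrow>
    (('s, 'f, 'r, 'u) struct,
     ('s, 'f, 'r, 'u) struct \<times> ('s \<Rightarrow> 'u \<Rightarrow> 'u) \<times> ('s, 'f, 'r, 'u) struct) cat" where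
  "Mod \<theta> \<Sigma> T =
    (let models = {M. structure_of \<theta> \<Sigma> M \<and> (\<forall>\<sigma>\<in>T. holds \<Sigma> M \<sigma>)} in
    \<lparr>Ob = models,
     Ar = {(M, h, N). M \<in> models \<and> N \<in> models \<and> homomorphism \<Sigma> M N h},
     Dom = (\<lambda>(M, h, N). M), Cod = (\<lambda>(M, h, N). N),
     Idn = (\<lambda>M. (M, \<lambda>s\<in>sorts \<Sigma>. restrict id (carr M s), M)),
     Cmp = (\<lambda>(N', g, K) (M, f, N). (M, \<lambda>s\<in>sorts \<Sigma>. compose (carr M s) (g s) (f s), K))\<rparr>)"

end

theory Submission
  imports Defs
begin

text \<open>
  A span \<open>X \<leftarrow> U \<rightarrow> Y\<close> of monomorphisms is sent by \<open>F\<close> to a span of homomorphisms that need not be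
  injective.  The proof replaces \<open>F U\<close> by its image.  For this, the images of \<open>F U\<close> in \<open>F X\<close> and in
  \<open>F Y\<close> must be the same structure: elements of \<open>F U\<close> must be identified in \<open>F X\<close> if and only if they
  are identified in \<open>F Y\<close>, and tuples from \<open>F U\<close> must satisfy the same relations in both.

  This follows from a description of \<open>lam\<close>-directed colimits in \<open>Mod \<theta> \<Sigma> T\<close>.  Arities and conjunctions
  have fewer than \<open>lam\<close> members, and fewer than \<open>lam\<close> facts that each hold at some stage hold together
  at a common bound of these stages.  So the colimit of the underlying sets, with the induced
  structure, is again a model (\<open>N_model\<close>).  Hence every such colimit of models is of this concrete form
  (\<open>colimit_concrete\<close>): its elements come from a stage, and an equality or a relation between elements
  of a stage that holds in the colimit holds already at a later stage.

  Now present \<open>U\<close> and \<open>X\<close> as directed colimits of generated objects \<open>U\<^sub>i\<close> and \<open>X\<^sub>j\<close>.  A coincidence in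
  \<open>F X\<close> of data from \<open>F U\<close> lives on some \<open>F U\<^sub>i\<close>.  The map \<open>U\<^sub>i \<rightarrow> X\<close> factors through some \<open>X\<^sub>j\<close>, and for
  large enough \<open>j\<close> the coincidence holds in \<open>F X\<^sub>j\<close>.  As \<open>X\<^sub>j\<close> is a generated subobject of \<open>X\<close>
  (\<open>colimit_mono\<close>), the back condition extends the span so that its apex contains \<open>X\<^sub>j\<close>, and then the
  map \<open>U\<^sub>i \<rightarrow> Y\<close> factors through \<open>X\<^sub>j\<close> as well (\<open>back_factor\<close>).  So the coincidence also holds in \<open>F Y\<close>;
  the converse uses the forth condition.

  The images are models because the theory is universal.  They form a dense set: by
  \<open>generated_range\<close>, a homomorphism from a generated model to \<open>F X\<close> has its values in the image of some
  \<open>F X\<^sub>j\<close>, since \<open>F X\<close> is the directed union of these images along inclusions, and the back condition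
  for \<open>X\<^sub>j\<close> in \<open>A\<close> yields the span that is required.
\<close>

section \<open>Tuples, homomorphisms and embeddings\<close>

text \<open>
  Argument tuples of function and relation symbols and valuations of variables are all of this form,
  so facts about tuples are proved once for an index set \<open>Q\<close> with sorts \<open>\<sigma>\<close>.
\<close>

definition tuples :: "'u set \<Rightarrow> ('u \<Rightarrow> 's) \<Rightarrow> ('s, 'f, 'r, 'u) struct \<Rightarrow> ('u \<Rightarrow> 'u) set" where
  "tuples Q \<sigma> M = (\<Pi>\<^sub>E p\<in>Q. carr M (\<sigma> p))"

definition tmap :: "'u set \<Rightarrow> ('u \<Rightarrow> 's) \<Rightarrow> ('s \<Rightarrow> 'u \<Rightarrow> 'u) \<Rightarrow> ('u \<Rightarrow> 'u) \<Rightarrow> 'u \<Rightarrow> 'u" where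
  "tmap Q \<sigma> h a = (\<lambda>p\<in>Q. h (\<sigma> p) (a p))"

abbreviation ftup where "ftup \<Sigma> f \<equiv> tuples (fargs \<Sigma> f) (fsort \<Sigma> f)"
abbreviation rtup where "rtup \<Sigma> R \<equiv> tuples (rargs \<Sigma> R) (rsort \<Sigma> R)"
abbreviation fmap where "fmap \<Sigma> f \<equiv> tmap (fargs \<Sigma> f) (fsort \<Sigma> f)"
abbreviation rmap where "rmap \<Sigma> R \<equiv> tmap (rargs \<Sigma> R) (rsort \<Sigma> R)"

lemma tuplesD: "a \<in> tuples Q \<sigma> M \<Longrightarrow> p \<in> Q \<Longrightarrow> a p \<in> carr M (\<sigma> p)"
  by (auto simp: tuples_def)

lemma tuplesI: "(\<And>p. p \<in> Q \<Longrightarrow> a p \<in> carr M (\<sigma> p)) \<Longrightarrow> a \<in> extensional Q \<Longrightarrow> a \<in> tuples Q \<sigma> M"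
  by (auto simp: tuples_def PiE_def)

lemma tuples_ext: "a \<in> tuples Q \<sigma> M \<Longrightarrow> a \<in> extensional Q"
  by (simp add: tuples_def PiE_def)

lemma tmap_apply [simp]: "p \<in> Q \<Longrightarrow> tmap Q \<sigma> h a p = h (\<sigma> p) (a p)"
  by (simp add: tmap_def)

lemma tmap_ext [simp]: "tmap Q \<sigma> h a \<in> extensional Q"
  by (simp add: tmap_def)

lemma tmap_cong: "(\<And>p. p \<in> Q \<Longrightarrow> h (\<sigma> p) (a p) = k (\<sigma> p) (b p)) \<Longrightarrow> tmap Q \<sigma> h a = tmap Q \<sigma> k b"
  by (auto simp: tmap_def)

lemma tmap_eqD: "tmap Q \<sigma> h a = tmap Q \<sigma> k b \<Longrightarrow> p \<in> Q \<Longrightarrow> h (\<sigma> p) (a p) = k (\<sigma> p) (b p)"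
  by (metis tmap_apply)

lemma tmap_tmap: "tmap Q \<sigma> k (tmap Q \<sigma> h a) = tmap Q \<sigma> (\<lambda>s x. k s (h s x)) a"
  by (auto simp: tmap_def)

lemma tmap_id: "a \<in> extensional Q \<Longrightarrow> (\<And>p. p \<in> Q \<Longrightarrow> h (\<sigma> p) (a p) = a p) \<Longrightarrow> tmap Q \<sigma> h a = a"
  by (rule extensionalityI[of _ Q]) auto

lemma lift_tuple:
  assumes "t \<in> extensional Q" and "\<And>p. p \<in> Q \<Longrightarrow> t p \<in> h (\<sigma> p) ` carr M (\<sigma> p)"
  obtains a where "a \<in> tuples Q \<sigma> M" and "t = tmap Q \<sigma> h a"
proof -
  have "\<forall>p\<in>Q. \<exists>x. x \<in> carr M (\<sigma> p) \<and> t p = h (\<sigma> p) x" using assms(2) by blast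
  then obtain b where b: "\<forall>p\<in>Q. b p \<in> carr M (\<sigma> p) \<and> t p = h (\<sigma> p) (b p)" by metis
  show thesis
  proof (rule that)
    show "restrict b Q \<in> tuples Q \<sigma> M" using b by (auto simp: tuples_def)
    show "t = tmap Q \<sigma> h (restrict b Q)"
      by (rule extensionalityI[of _ Q]) (use assms(1) b in auto)
  qed
qed

lemma homI:
  assumes "h \<in> (\<Pi>\<^sub>E s\<in>sorts \<Sigma>. carr M s \<rightarrow>\<^sub>E carr N s)"
    and "\<And>f a. f \<in> funs \<Sigma> \<Longrightarrow> a \<in> ftup \<Sigma> f M \<Longrightarrow> h (fres \<Sigma> f) (fint M f a) = fint N f (fmap \<Sigma> f h a)"
    and "\<And>R a. R \<in> rels \<Sigma> \<Longrightarrow> a \<in> rint M R \<Longrightarrow> rmap \<Sigma> R h a \<in> rint N R"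
  shows "homomorphism \<Sigma> M N h"
  using assms unfolding homomorphism_def fun_tuples_def tuples_def tmap_def by blast

lemma hom_carr: "homomorphism \<Sigma> M N h \<Longrightarrow> s \<in> sorts \<Sigma> \<Longrightarrow> a \<in> carr M s \<Longrightarrow> h s a \<in> carr N s"
  unfolding homomorphism_def by (meson PiE_mem)

lemma hom_PiE: "homomorphism \<Sigma> M N h \<Longrightarrow> h \<in> (\<Pi>\<^sub>E s\<in>sorts \<Sigma>. carr M s \<rightarrow>\<^sub>E carr N s)"
  unfolding homomorphism_def by blast

lemma hom_fint:
  "homomorphism \<Sigma> M N h \<Longrightarrow> f \<in> funs \<Sigma> \<Longrightarrow> a \<in> ftup \<Sigma> f M \<Longrightarrow>
    h (fres \<Sigma> f) (fint M f a) = fint N f (fmap \<Sigma> f h a)"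
  unfolding homomorphism_def fun_tuples_def tuples_def tmap_def by blast

lemma hom_rint:
  "homomorphism \<Sigma> M N h \<Longrightarrow> R \<in> rels \<Sigma> \<Longrightarrow> a \<in> rint M R \<Longrightarrow> rmap \<Sigma> R h a \<in> rint N R"
  unfolding homomorphism_def tmap_def by blast

lemma hom_tuples:
  "homomorphism \<Sigma> M N h \<Longrightarrow> \<sigma> ` Q \<subseteq> sorts \<Sigma> \<Longrightarrow> a \<in> tuples Q \<sigma> M \<Longrightarrow> tmap Q \<sigma> h a \<in> tuples Q \<sigma> N"
  by (rule tuplesI) (use tuplesD[of a Q \<sigma> M] hom_carr[of \<Sigma> M N h] in auto)

lemma hom_eqI:
  assumes "homomorphism \<Sigma> M N h" "homomorphism \<Sigma> M K k"
    and "\<And>s a. s \<in> sorts \<Sigma> \<Longrightarrow> a \<in> carr M s \<Longrightarrow> h s a = k s a"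
  shows "h = k"
proof (rule extensionalityI[of _ "sorts \<Sigma>"])
  fix s assume s: "s \<in> sorts \<Sigma>"
  have "h s \<in> extensional (carr M s)" "k s \<in> extensional (carr M s)"
    using PiE_mem[OF hom_PiE[OF assms(1)] s] PiE_mem[OF hom_PiE[OF assms(2)] s]
    by (simp_all add: PiE_def)
  then show "h s = k s" by (rule extensionalityI) (use assms(3) s in auto)
next
  show "h \<in> extensional (sorts \<Sigma>)" "k \<in> extensional (sorts \<Sigma>)"
    using hom_PiE[OF assms(1)] hom_PiE[OF assms(2)] by (simp_all add: PiE_def)
qed

definition hcomp where
  "hcomp \<Sigma> M g f = (\<lambda>s\<in>sorts \<Sigma>. compose (carr M s) (g s) (f s))"

definition hid where
  "hid \<Sigma> M = (\<lambda>s\<in>sorts \<Sigma>. restrict id (carr M s))"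

lemma hcomp_apply [simp]: "s \<in> sorts \<Sigma> \<Longrightarrow> a \<in> carr M s \<Longrightarrow> hcomp \<Sigma> M g f s a = g s (f s a)"
  by (simp add: hcomp_def compose_def)

lemma hid_apply [simp]: "s \<in> sorts \<Sigma> \<Longrightarrow> a \<in> carr M s \<Longrightarrow> hid \<Sigma> M s a = a"
  by (simp add: hid_def)

text \<open>Isomorphisms onto induced substructures.\<close>

definition embedding where
  "embedding \<Sigma> M N h \<longleftrightarrow> homomorphism \<Sigma> M N h \<and> (\<forall>s\<in>sorts \<Sigma>. inj_on (h s) (carr M s)) \<and>
    (\<forall>R\<in>rels \<Sigma>. \<forall>a\<in>rtup \<Sigma> R M. rmap \<Sigma> R h a \<in> rint N R \<longrightarrow> a \<in> rint M R)"

lemma embedding_hom: "embedding \<Sigma> M N h \<Longrightarrow> homomorphism \<Sigma> M N h"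
  by (simp add: embedding_def)

lemma embedding_inj:
  "embedding \<Sigma> M N h \<Longrightarrow> s \<in> sorts \<Sigma> \<Longrightarrow> a \<in> carr M s \<Longrightarrow> b \<in> carr M s \<Longrightarrow> h s a = h s b \<Longrightarrow> a = b"
  by (auto simp: embedding_def inj_on_def)

lemma embedding_rint:
  "embedding \<Sigma> M N h \<Longrightarrow> R \<in> rels \<Sigma> \<Longrightarrow> a \<in> rtup \<Sigma> R M \<Longrightarrow> rmap \<Sigma> R h a \<in> rint N R \<Longrightarrow> a \<in> rint M R"
  by (auto simp: embedding_def)


section \<open>Models of a basic universal theory\<close>

locale universal_theory =
  fixes \<theta> :: "'u rel" and lam :: "'l rel" and \<kappa> :: "'k rel"
    and \<Sigma> :: "('s, 'f, 'r, 'u) lang" and T :: "('s, 'f, 'r, 'u) sentence set"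
  assumes theta_inf: "Cinfinite \<theta>" and theta_reg: "regularCard \<theta>"
    and lam_inf: "Cinfinite lam" and kappa_lam: "\<kappa> \<le>o lam"
    and language: "language \<theta> \<kappa> \<Sigma>" and basic_universal: "basic_universal_theory \<theta> lam \<kappa> \<Sigma> T"
begin

abbreviation struc where "struc \<equiv> structure_of \<theta> \<Sigma>"
abbreviation homo where "homo \<equiv> homomorphism \<Sigma>"
abbreviation \<M> where "\<M> \<equiv> Mod \<theta> \<Sigma> T"

lemma fsorts: "f \<in> funs \<Sigma> \<Longrightarrow> fsort \<Sigma> f ` fargs \<Sigma> f \<subseteq> sorts \<Sigma>"
  and fres_sort: "f \<in> funs \<Sigma> \<Longrightarrow> fres \<Sigma> f \<in> sorts \<Sigma>"
  and rsorts: "R \<in> rels \<Sigma> \<Longrightarrow> rsort \<Sigma> R ` rargs \<Sigma> R \<subseteq> sorts \<Sigma>"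
  using language by (auto simp: language_def)

lemma fsort_in [simp]: "f \<in> funs \<Sigma> \<Longrightarrow> p \<in> fargs \<Sigma> f \<Longrightarrow> fsort \<Sigma> f p \<in> sorts \<Sigma>"
  and rsort_in [simp]: "R \<in> rels \<Sigma> \<Longrightarrow> p \<in> rargs \<Sigma> R \<Longrightarrow> rsort \<Sigma> R p \<in> sorts \<Sigma>"
  using fsorts rsorts by blast+

lemma less_lam: "|X| <o \<kappa> \<Longrightarrow> |X| <o lam"
  using kappa_lam ordLess_ordLeq_trans by blast

lemma fargs_lam: "f \<in> funs \<Sigma> \<Longrightarrow> |fargs \<Sigma> f| <o lam"
  and rargs_lam: "R \<in> rels \<Sigma> \<Longrightarrow> |rargs \<Sigma> R| <o lam"
  using language by (auto simp: language_def intro: less_lam)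

lemma struc_fint: "struc M \<Longrightarrow> f \<in> funs \<Sigma> \<Longrightarrow> a \<in> ftup \<Sigma> f M \<Longrightarrow> fint M f a \<in> carr M (fres \<Sigma> f)"
  using PiE_mem[of "fint M f" "ftup \<Sigma> f M" "\<lambda>_. carr M (fres \<Sigma> f)" a]
  by (simp add: structure_of_def fun_tuples_def tuples_def)

lemma struc_rint: "struc M \<Longrightarrow> R \<in> rels \<Sigma> \<Longrightarrow> a \<in> rint M R \<Longrightarrow> a \<in> rtup \<Sigma> R M"
  unfolding structure_of_def rel_tuples_def tuples_def by blast

lemma homo_comp:
  assumes M: "struc M" and f: "homo M N f" and g: "homo N K g"
  shows "homo M K (hcomp \<Sigma> M g f)"
proof (rule homI)
  show "hcomp \<Sigma> M g f \<in> (\<Pi>\<^sub>E s\<in>sorts \<Sigma>. carr M s \<rightarrow>\<^sub>E carr K s)"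
    using hom_carr[OF f] hom_carr[OF g] by (auto simp: hcomp_def compose_def)
next
  fix F a assume F: "F \<in> funs \<Sigma>" and a: "a \<in> ftup \<Sigma> F M"
  have "g (fres \<Sigma> F) (f (fres \<Sigma> F) (fint M F a)) = fint K F (fmap \<Sigma> F g (fmap \<Sigma> F f a))"
    using F a f g fsorts by (simp add: hom_fint hom_tuples)
  also have "fmap \<Sigma> F g (fmap \<Sigma> F f a) = fmap \<Sigma> F (hcomp \<Sigma> M g f) a"
    unfolding tmap_tmap by (rule tmap_cong) (use F tuplesD[OF a] in auto)
  finally show "hcomp \<Sigma> M g f (fres \<Sigma> F) (fint M F a) = fint K F (fmap \<Sigma> F (hcomp \<Sigma> M g f) a)"
    using F a M by (simp add: fres_sort struc_fint)
next
  fix R a assume R: "R \<in> rels \<Sigma>" and a: "a \<in> rint M R"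
  have "rmap \<Sigma> R g (rmap \<Sigma> R f a) \<in> rint K R" using R a f g by (simp add: hom_rint)
  also have "rmap \<Sigma> R g (rmap \<Sigma> R f a) = rmap \<Sigma> R (hcomp \<Sigma> M g f) a"
    unfolding tmap_tmap by (rule tmap_cong) (use R tuplesD[OF struc_rint[OF M R a]] in auto)
  finally show "rmap \<Sigma> R (hcomp \<Sigma> M g f) a \<in> rint K R" .
qed

lemma homo_id:
  assumes M: "struc M"
  shows "homo M M (hid \<Sigma> M)"
proof (rule homI)
  show "hid \<Sigma> M \<in> (\<Pi>\<^sub>E s\<in>sorts \<Sigma>. carr M s \<rightarrow>\<^sub>E carr M s)" by (auto simp: hid_def)
next
  fix F a assume F: "F \<in> funs \<Sigma>" and a: "a \<in> ftup \<Sigma> F M"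
  have "fmap \<Sigma> F (hid \<Sigma> M) a = a"
    by (rule tmap_id[OF tuples_ext[OF a]]) (use F tuplesD[OF a] in auto)
  then show "hid \<Sigma> M (fres \<Sigma> F) (fint M F a) = fint M F (fmap \<Sigma> F (hid \<Sigma> M) a)"
    using F a M by (simp add: fres_sort struc_fint)
next
  fix R a assume R: "R \<in> rels \<Sigma>" and a: "a \<in> rint M R"
  note ra = struc_rint[OF M R a]
  have "rmap \<Sigma> R (hid \<Sigma> M) a = a"
    by (rule tmap_id[OF tuples_ext[OF ra]]) (use R tuplesD[OF ra] in auto)
  then show "rmap \<Sigma> R (hid \<Sigma> M) a \<in> rint M R" using a by simp
qed

lemma Mod_sel:
  "Ob \<M> = {M. struc M \<and> (\<forall>\<sigma>\<in>T. holds \<Sigma> M \<sigma>)}"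
  "Ar \<M> = {(M, h, N). M \<in> Ob \<M> \<and> N \<in> Ob \<M> \<and> homo M N h}"
  "Dom \<M> (M, h, N) = M" "Cod \<M> (M, h, N) = N"
  "Idn \<M> M = (M, hid \<Sigma> M, M)"
  "Cmp \<M> (N', g, K) (M, h, N) = (M, hcomp \<Sigma> M g h, K)"
  by (simp_all add: Mod_def Let_def hid_def hcomp_def)

lemma Mod_hom: "u \<in> hom \<M> M N \<longleftrightarrow> M \<in> Ob \<M> \<and> N \<in> Ob \<M> \<and> (\<exists>h. u = (M, h, N) \<and> homo M N h)"
  by (cases u) (auto simp: hom_def Mod_sel(2-4))

lemma Mod_homI: "M \<in> Ob \<M> \<Longrightarrow> N \<in> Ob \<M> \<Longrightarrow> homo M N h \<Longrightarrow> (M, h, N) \<in> hom \<M> M N"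
  by (simp add: Mod_hom)

lemma model_struc: "M \<in> Ob \<M> \<Longrightarrow> struc M"
  by (simp add: Mod_sel(1))

lemma category_Mod: "category \<M>"
proof
  show "f \<in> Ar \<M> \<Longrightarrow> Dom \<M> f \<in> Ob \<M> \<and> Cod \<M> f \<in> Ob \<M>" for f
    by (auto simp: Mod_sel(2-4))
  show "a \<in> Ob \<M> \<Longrightarrow> Idn \<M> a \<in> hom \<M> a a" for a
    by (simp add: Mod_sel(5) Mod_homI homo_id model_struc)
  show "f \<in> hom \<M> a b \<Longrightarrow> g \<in> hom \<M> b c \<Longrightarrow> Cmp \<M> g f \<in> hom \<M> a c" for f g a b c
    by (clarsimp simp: Mod_hom Mod_sel(6)) (rule homo_comp[OF model_struc])
  show "Cmp \<M> (Idn \<M> b) f = f" if f: "f \<in> hom \<M> a b" for f a b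
  proof -
    obtain h where h: "f = (a, h, b)" "homo a b h" "struc a" "struc b"
      using f by (auto simp: Mod_hom model_struc)
    have "hcomp \<Sigma> a (hid \<Sigma> b) h = h"
      by (rule hom_eqI[OF homo_comp[OF h(3,2) homo_id[OF h(4)]] h(2)]) (use hom_carr[OF h(2)] in simp)
    then show ?thesis by (simp add: h(1) Mod_sel(5,6))
  qed
  show "Cmp \<M> f (Idn \<M> a) = f" if f: "f \<in> hom \<M> a b" for f a b
  proof -
    obtain h where h: "f = (a, h, b)" "homo a b h" "struc a"
      using f by (auto simp: Mod_hom model_struc)
    have "hcomp \<Sigma> a h (hid \<Sigma> a) = h"
      by (rule hom_eqI[OF homo_comp[OF h(3) homo_id[OF h(3)] h(2)] h(2)]) simp
    then show ?thesis by (simp add: h(1) Mod_sel(5,6))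
  qed
  show "Cmp \<M> h (Cmp \<M> g f) = Cmp \<M> (Cmp \<M> h g) f"
    if fgh: "f \<in> hom \<M> a b" "g \<in> hom \<M> b c" "h \<in> hom \<M> c d" for f g h a b c d
  proof -
    obtain f' g' h' where e: "f = (a, f', b)" "g = (b, g', c)" "h = (c, h', d)"
      and hs: "homo a b f'" "homo b c g'" "homo c d h'" and st: "struc a" "struc b"
      using fgh by (auto simp: Mod_hom model_struc)
    have "hcomp \<Sigma> a h' (hcomp \<Sigma> a g' f') = hcomp \<Sigma> a (hcomp \<Sigma> b h' g') f'"
      by (rule hom_eqI[OF homo_comp[OF st(1) homo_comp[OF st(1) hs(1,2)] hs(3)]
            homo_comp[OF st(1) hs(1) homo_comp[OF st(2) hs(2,3)]]]) (use hom_carr[OF hs(1)] in simp)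
    then show ?thesis by (simp add: e Mod_sel(6))
  qed
qed

text \<open>
  The formulas of the theory are positive and quantifier-free.  By induction, homomorphisms preserve
  them, and embeddings, which reflect the atomic ones, reflect all of them.
\<close>

lemma eval_sort:
  assumes "has_sort \<Sigma> X \<Gamma> t s" and "struc M" and "\<Gamma> ` X \<subseteq> sorts \<Sigma>" and "v \<in> tuples X \<Gamma> M"
  shows "eval \<Sigma> M v t \<in> carr M s \<and> s \<in> sorts \<Sigma>"
  using assms(1)
proof induction
  case (2 f t)
  then show ?case
    using fres_sort struc_fint[OF assms(2)] by (auto simp: tuples_def)
qed (use assms(3) tuplesD[OF assms(4)] in auto)

lemma eval_hom:
  assumes "has_sort \<Sigma> X \<Gamma> t s" and "struc M" and "homo M N h"
    and "\<Gamma> ` X \<subseteq> sorts \<Sigma>" and "v \<in> tuples X \<Gamma> M"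
  shows "eval \<Sigma> N (tmap X \<Gamma> h v) t = h s (eval \<Sigma> M v t)"
  using assms(1)
proof induction
  case (2 f t)
  let ?a = "\<lambda>p\<in>fargs \<Sigma> f. eval \<Sigma> M v (t p)"
  have a: "?a \<in> ftup \<Sigma> f M"
    using 2 eval_sort[OF _ assms(2,4,5)] by (auto simp: tuples_def)
  have "(\<lambda>p\<in>fargs \<Sigma> f. eval \<Sigma> N (tmap X \<Gamma> h v) (t p)) = fmap \<Sigma> f h ?a"
    by (rule extensionalityI[of _ "fargs \<Sigma> f"]) (use 2 in auto)
  then show ?case using hom_fint[OF assms(3) 2(1) a] by simp
qed simp

lemma Rel_args_tuple:
  assumes "\<And>p. p \<in> rargs \<Sigma> R \<Longrightarrow> has_sort \<Sigma> X \<Gamma> (t p) (rsort \<Sigma> R p)" and "struc M"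
    and "\<Gamma> ` X \<subseteq> sorts \<Sigma>" and "v \<in> tuples X \<Gamma> M"
  shows "(\<lambda>p\<in>rargs \<Sigma> R. eval \<Sigma> M v (t p)) \<in> rtup \<Sigma> R M"
  using assms eval_sort[OF _ assms(2-4)] by (auto simp: tuples_def)

lemma Rel_args_hom:
  assumes "\<And>p. p \<in> rargs \<Sigma> R \<Longrightarrow> has_sort \<Sigma> X \<Gamma> (t p) (rsort \<Sigma> R p)" and "struc M" and "homo M N h"
    and "\<Gamma> ` X \<subseteq> sorts \<Sigma>" and "v \<in> tuples X \<Gamma> M"
  shows "(\<lambda>p\<in>rargs \<Sigma> R. eval \<Sigma> N (tmap X \<Gamma> h v) (t p)) = rmap \<Sigma> R h (\<lambda>p\<in>rargs \<Sigma> R. eval \<Sigma> M v (t p))"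
  by (rule extensionalityI[of _ "rargs \<Sigma> R"]) (use eval_hom[OF assms(1) assms(2-5)] in auto)

lemma sat_hom:
  assumes "wf_form \<theta> lam \<Sigma> X \<Gamma> \<phi>" and "struc M" and "homo M N h"
    and "\<Gamma> ` X \<subseteq> sorts \<Sigma>" and "v \<in> tuples X \<Gamma> M" and "sat \<Sigma> M v \<phi>"
  shows "sat \<Sigma> N (tmap X \<Gamma> h v) \<phi>"
  using assms(1,6)
proof induction
  case (1 t s t')
  then show ?case using eval_hom[OF _ assms(2-5)] by simp
next
  case (2 R t)
  then show ?case
    using Rel_args_hom[OF 2(2) assms(2-5)] hom_rint[OF assms(3) 2(1)] by simp
qed auto

lemma sat_embedding:
  assumes "wf_form \<theta> lam \<Sigma> X \<Gamma> \<phi>" and "struc M" and e: "embedding \<Sigma> M N h"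
    and "\<Gamma> ` X \<subseteq> sorts \<Sigma>" and "v \<in> tuples X \<Gamma> M" and "sat \<Sigma> N (tmap X \<Gamma> h v) \<phi>"
  shows "sat \<Sigma> M v \<phi>"
  using assms(1,6)
proof induction
  case (1 t s t')
  then show ?case
    using eval_hom[OF _ assms(2) embedding_hom[OF e] assms(4,5)] eval_sort[OF _ assms(2,4,5)]
      embedding_inj[OF e] by simp metis
next
  case (2 R t)
  then show ?case
    using Rel_args_hom[OF 2(2) assms(2) embedding_hom[OF e] assms(4,5)]
      Rel_args_tuple[OF 2(2) assms(2,4,5)] embedding_rint[OF e 2(1)] by simp
qed auto

lemma theory_wf:
  assumes "All_Imp X \<Gamma> \<phi> \<psi> \<in> T"
  shows "|X| <o lam" "\<Gamma> ` X \<subseteq> sorts \<Sigma>" "wf_form \<theta> lam \<Sigma> X \<Gamma> \<phi>" "wf_form \<theta> lam \<Sigma> X \<Gamma> \<psi>"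
proof -
  have "wf_sentence \<theta> lam \<kappa> \<Sigma> (All_Imp X \<Gamma> \<phi> \<psi>)"
    using basic_universal assms unfolding basic_universal_theory_def by blast
  then show "|X| <o lam" "\<Gamma> ` X \<subseteq> sorts \<Sigma>" "wf_form \<theta> lam \<Sigma> X \<Gamma> \<phi>" "wf_form \<theta> lam \<Sigma> X \<Gamma> \<psi>"
    by (simp_all add: less_lam)
qed

text \<open>
  A valuation in a substructure is also one in the larger model, where the quantifier-free formulas
  have the same truth values.
\<close>

lemma model_embedding:
  assumes M: "struc M" and N: "N \<in> Ob \<M>" and e: "embedding \<Sigma> M N h"
  shows "M \<in> Ob \<M>"
proof -
  have "holds \<Sigma> M \<sigma>" if "\<sigma> \<in> T" for \<sigma>
  proof (cases \<sigma>)
    case (All_Imp X \<Gamma> \<phi> \<psi>)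
    have wf: "\<Gamma> ` X \<subseteq> sorts \<Sigma>" "wf_form \<theta> lam \<Sigma> X \<Gamma> \<phi>" "wf_form \<theta> lam \<Sigma> X \<Gamma> \<psi>"
      using that All_Imp by (simp_all add: theory_wf)
    have "sat \<Sigma> M v \<psi>" if v: "v \<in> tuples X \<Gamma> M" and s: "sat \<Sigma> M v \<phi>" for v
    proof -
      have "sat \<Sigma> N (tmap X \<Gamma> h v) \<phi>"
        using sat_hom[OF wf(2) M embedding_hom[OF e] wf(1) v s] .
      moreover have "tmap X \<Gamma> h v \<in> tuples X \<Gamma> N"
        using hom_tuples[OF embedding_hom[OF e] wf(1) v] .
      moreover have "holds \<Sigma> N \<sigma>" using N \<open>\<sigma> \<in> T\<close> by (simp add: Mod_sel(1))
      ultimately have "sat \<Sigma> N (tmap X \<Gamma> h v) \<psi>"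
        using All_Imp by (auto simp: tuples_def)
      then show ?thesis using sat_embedding[OF wf(3) M e wf(1) v] by blast
    qed
    then show ?thesis using All_Imp by (auto simp: tuples_def)
  qed
  then show ?thesis using M by (simp add: Mod_sel(1))
qed

end


section \<open>Directed colimits of models\<close>

locale directed_index =
  fixes lam :: "'l rel" and P :: "'u set" and r :: "'u rel"
  assumes card_inf: "Cinfinite lam" and directed: "directed_poset lam P r"
begin

lemma poset: "partial_order_on P r"
  using directed by (simp add: directed_poset_def)

lemma r_in: "(i, j) \<in> r \<Longrightarrow> i \<in> P \<and> j \<in> P"
  using partial_order_onD(4)[OF poset] by auto

lemma r_refl: "i \<in> P \<Longrightarrow> (i, i) \<in> r"
  using partial_order_onD(1)[OF poset] by (auto simp: refl_on_def)

lemma r_trans: "(i, j) \<in> r \<Longrightarrow> (j, k) \<in> r \<Longrightarrow> (i, k) \<in> r"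
  using partial_order_onD(2)[OF poset] by (auto dest: transD)

lemma upper2:
  assumes "i \<in> P" and "j \<in> P"
  obtains k where "k \<in> P" and "(i, k) \<in> r" and "(j, k) \<in> r"
proof -
  have "|{i, j}| <o lam"
    using card_inf
    by (intro Cfinite_ordLess_Cinfinite) (auto simp: cfinite_def Field_card_of card_of_card_order_on)
  then have "\<exists>k\<in>P. \<forall>x\<in>{i, j}. (x, k) \<in> r"
    using directed assms unfolding directed_poset_def by (metis empty_subsetI insert_subset)
  then show thesis using that by auto
qed

lemma upper_family:
  assumes "|I| <o lam" and "g ` I \<subseteq> P" and "i \<in> P"
  obtains k where "k \<in> P" and "(i, k) \<in> r" and "\<And>x. x \<in> I \<Longrightarrow> (g x, k) \<in> r"
proof -
  have "|g ` I| <o lam" using assms(1) card_of_image ordLeq_ordLess_trans by blast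
  then obtain d where d: "d \<in> P" "\<forall>x\<in>g ` I. (x, d) \<in> r"
    using directed assms(2) unfolding directed_poset_def by blast
  obtain k where "k \<in> P" "(i, k) \<in> r" "(d, k) \<in> r" using upper2[OF assms(3) d(1)] .
  then show thesis using that d(2) r_trans by blast
qed

end

lemma poset_cat_simps [simp]:
  "Ob (poset_cat P r) = P" "Ar (poset_cat P r) = r" "Dom (poset_cat P r) u = fst u"
  "Cod (poset_cat P r) u = snd u" "Idn (poset_cat P r) i = (i, i)"
  "Cmp (poset_cat P r) v u = (fst u, snd v)"
  by (simp_all add: poset_cat_def)

locale directed_models = universal_theory \<theta> lam \<kappa> \<Sigma> T + directed_index lam P r
  for \<theta> :: "'u rel" and lam :: "'l rel" and \<kappa> :: "'k rel"
    and \<Sigma> :: "('s, 'f, 'r, 'u) lang" and T :: "('s, 'f, 'r, 'u) sentence set"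
    and P :: "'u set" and r :: "'u rel" +
  fixes M :: "'u \<Rightarrow> ('s, 'f, 'r, 'u) struct" and h :: "'u \<Rightarrow> 'u \<Rightarrow> 's \<Rightarrow> 'u \<Rightarrow> 'u"
  assumes small_P: "small \<theta> P"
    and model: "i \<in> P \<Longrightarrow> M i \<in> Ob (Mod \<theta> \<Sigma> T)"
    and map_hom: "(i, j) \<in> r \<Longrightarrow> homomorphism \<Sigma> (M i) (M j) (h i j)"
    and map_id: "i \<in> P \<Longrightarrow> s \<in> sorts \<Sigma> \<Longrightarrow> a \<in> carr (M i) s \<Longrightarrow> h i i s a = a"
    and map_comp: "(i, j) \<in> r \<Longrightarrow> (j, k) \<in> r \<Longrightarrow> s \<in> sorts \<Sigma> \<Longrightarrow> a \<in> carr (M i) s \<Longrightarrow>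
      h j k s (h i j s a) = h i k s a"
begin

lemma M_struc: "i \<in> P \<Longrightarrow> struc (M i)"
  by (simp add: model model_struc)

lemma map_carr: "(i, j) \<in> r \<Longrightarrow> s \<in> sorts \<Sigma> \<Longrightarrow> a \<in> carr (M i) s \<Longrightarrow> h i j s a \<in> carr (M j) s"
  by (rule hom_carr[OF map_hom])

lemma map_tuples: "(i, j) \<in> r \<Longrightarrow> \<sigma> ` Q \<subseteq> sorts \<Sigma> \<Longrightarrow> a \<in> tuples Q \<sigma> (M i) \<Longrightarrow>
    tmap Q \<sigma> (h i j) a \<in> tuples Q \<sigma> (M j)"
  by (rule hom_tuples[OF map_hom])

lemma tmap_comp:
  assumes "(i, j) \<in> r" "(j, k) \<in> r" "\<sigma> ` Q \<subseteq> sorts \<Sigma>" "a \<in> tuples Q \<sigma> (M i)"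
  shows "tmap Q \<sigma> (h j k) (tmap Q \<sigma> (h i j) a) = tmap Q \<sigma> (h i k) a"
  unfolding tmap_tmap
  by (rule tmap_cong) (use map_comp[OF assms(1,2)] tuplesD[OF assms(4)] assms(3) in auto)

end

text \<open>
  Two elements of stages have the same germ if they become equal at a later stage.  A cocone of
  maps is separated if it identifies only elements with the same germ.
\<close>

locale separated_cocone = directed_models \<theta> lam \<kappa> \<Sigma> T P r M h
  for \<theta> :: "'u rel" and lam :: "'l rel" and \<kappa> :: "'k rel"
    and \<Sigma> :: "('s, 'f, 'r, 'u) lang" and T :: "('s, 'f, 'r, 'u) sentence set"
    and P :: "'u set" and r :: "'u rel"
    and M :: "'u \<Rightarrow> ('s, 'f, 'r, 'u) struct" and h :: "'u \<Rightarrow> 'u \<Rightarrow> 's \<Rightarrow> 'u \<Rightarrow> 'u" +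
  fixes q :: "'u \<Rightarrow> 's \<Rightarrow> 'u \<Rightarrow> 'u"
  assumes q_comp: "(i, j) \<in> r \<Longrightarrow> s \<in> sorts \<Sigma> \<Longrightarrow> a \<in> carr (M i) s \<Longrightarrow> q j s (h i j s a) = q i s a"
    and eq_reflect: "i \<in> P \<Longrightarrow> s \<in> sorts \<Sigma> \<Longrightarrow> a \<in> carr (M i) s \<Longrightarrow> b \<in> carr (M i) s \<Longrightarrow>
      q i s a = q i s b \<Longrightarrow> \<exists>k. (i, k) \<in> r \<and> h i k s a = h i k s b"
begin

lemma q_tmap_comp:
  assumes "(i, j) \<in> r" "\<sigma> ` Q \<subseteq> sorts \<Sigma>" "a \<in> tuples Q \<sigma> (M i)"
  shows "tmap Q \<sigma> (q j) (tmap Q \<sigma> (h i j) a) = tmap Q \<sigma> (q i) a"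
  unfolding tmap_tmap
  by (rule tmap_cong) (use q_comp[OF assms(1)] tuplesD[OF assms(3)] assms(2) in auto)

lemma eq_reflect2:
  assumes i: "i \<in> P" and j: "j \<in> P" and s: "s \<in> sorts \<Sigma>"
    and a: "a \<in> carr (M i) s" and b: "b \<in> carr (M j) s" and eq: "q i s a = q j s b"
  obtains k where "(i, k) \<in> r" and "(j, k) \<in> r" and "h i k s a = h j k s b"
proof -
  obtain k where k: "k \<in> P" "(i, k) \<in> r" "(j, k) \<in> r" using upper2[OF i j] .
  have "q k s (h i k s a) = q k s (h j k s b)" using k s a b eq by (simp add: q_comp)
  then obtain l where l: "(k, l) \<in> r" "h k l s (h i k s a) = h k l s (h j k s b)"
    using eq_reflect[OF k(1) s map_carr[OF k(2) s a] map_carr[OF k(3) s b]] by blast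
  then have "h i l s a = h j l s b"
    using map_comp[OF k(2) l(1) s a] map_comp[OF k(3) l(1) s b] by simp
  then show thesis using that r_trans k l(1) by blast
qed

text \<open>
  A tuple has fewer than \<open>lam\<close> positions, so the stages from which its entries come have a common bound.
\<close>

lemma tuple_stage:
  assumes "|Q| <o lam" and "\<sigma> ` Q \<subseteq> sorts \<Sigma>" and "t \<in> extensional Q"
    and "\<And>p. p \<in> Q \<Longrightarrow> \<exists>i\<in>P. t p \<in> q i (\<sigma> p) ` carr (M i) (\<sigma> p)"
  obtains i a where "i \<in> P" and "a \<in> tuples Q \<sigma> (M i)" and "t = tmap Q \<sigma> (q i) a"
proof -
  obtain g where g: "\<And>p. p \<in> Q \<Longrightarrow> g p \<in> P \<and> t p \<in> q (g p) (\<sigma> p) ` carr (M (g p)) (\<sigma> p)"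
    using assms(4) by metis
  have "|{} :: 'u set| <o lam" using ordLeq_ordLess_trans[OF card_of_empty assms(1)] .
  then obtain i where "i \<in> P" using directed unfolding directed_poset_def by blast
  then obtain k where k: "k \<in> P" "\<And>p. p \<in> Q \<Longrightarrow> (g p, k) \<in> r"
    using upper_family[of Q g i] assms(1) g by blast
  have "t p \<in> q k (\<sigma> p) ` carr (M k) (\<sigma> p)" if p: "p \<in> Q" for p
  proof -
    have s: "\<sigma> p \<in> sorts \<Sigma>" using p assms(2) by blast
    obtain x where x: "x \<in> carr (M (g p)) (\<sigma> p)" "t p = q (g p) (\<sigma> p) x" using g[OF p] by blast
    show ?thesis
      using q_comp[OF k(2)[OF p] s x(1)] map_carr[OF k(2)[OF p] s x(1)] x(2) by (metis imageI)
  qed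
  then obtain a where "a \<in> tuples Q \<sigma> (M k)" "t = tmap Q \<sigma> (q k) a"
    using lift_tuple[OF assms(3), of "q k" \<sigma> "M k"] by blast
  then show thesis using that k(1) by blast
qed

text \<open>
  The same bounding argument, applied to stages at which single entries become equal.
\<close>

lemma tuple_eq_reflect:
  assumes Q: "|Q| <o lam" "\<sigma> ` Q \<subseteq> sorts \<Sigma>" and i: "i \<in> P" and j: "j \<in> P"
    and a: "a \<in> tuples Q \<sigma> (M i)" and b: "b \<in> tuples Q \<sigma> (M j)"
    and eq: "tmap Q \<sigma> (q i) a = tmap Q \<sigma> (q j) b"
  obtains k where "(i, k) \<in> r" and "(j, k) \<in> r" and "tmap Q \<sigma> (h i k) a = tmap Q \<sigma> (h j k) b"
proof -
  have "\<exists>k. (i, k) \<in> r \<and> (j, k) \<in> r \<and> h i k (\<sigma> p) (a p) = h j k (\<sigma> p) (b p)" if p: "p \<in> Q" for p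
    using eq_reflect2[OF i j _ tuplesD[OF a p] tuplesD[OF b p] tmap_eqD[OF eq p]] p Q(2) by blast
  then obtain g where g: "\<And>p. p \<in> Q \<Longrightarrow> (i, g p) \<in> r \<and> (j, g p) \<in> r \<and>
      h i (g p) (\<sigma> p) (a p) = h j (g p) (\<sigma> p) (b p)" by metis
  have gP: "g ` Q \<subseteq> P" using g r_in by blast
  obtain l where l: "l \<in> P" "(i, l) \<in> r" "(j, l) \<in> r" using upper2[OF i j] .
  obtain k where k: "k \<in> P" "(l, k) \<in> r" "\<And>p. p \<in> Q \<Longrightarrow> (g p, k) \<in> r"
    using upper_family[OF Q(1) gP l(1)] by blast
  have "tmap Q \<sigma> (h i k) a = tmap Q \<sigma> (h j k) b"
  proof (rule tmap_cong)
    fix p assume p: "p \<in> Q"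
    have s: "\<sigma> p \<in> sorts \<Sigma>" using p Q(2) by blast
    have ig: "(i, g p) \<in> r" and jg: "(j, g p) \<in> r" and e: "h i (g p) (\<sigma> p) (a p) = h j (g p) (\<sigma> p) (b p)"
      using g[OF p] by auto
    show "h i k (\<sigma> p) (a p) = h j k (\<sigma> p) (b p)"
      using map_comp[OF ig k(3)[OF p] s tuplesD[OF a p]] map_comp[OF jg k(3)[OF p] s tuplesD[OF b p]] e
      by simp
  qed
  then show thesis using that l k r_trans by blast
qed

end

text \<open>
  The colimit of the underlying sets, with the structure that the stages induce.
\<close>

locale concrete_colimit = separated_cocone \<theta> lam \<kappa> \<Sigma> T P r M h q
  for \<theta> :: "'u rel" and lam :: "'l rel" and \<kappa> :: "'k rel"
    and \<Sigma> :: "('s, 'f, 'r, 'u) lang" and T :: "('s, 'f, 'r, 'u) sentence set"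
    and P :: "'u set" and r :: "'u rel"
    and M :: "'u \<Rightarrow> ('s, 'f, 'r, 'u) struct" and h :: "'u \<Rightarrow> 'u \<Rightarrow> 's \<Rightarrow> 'u \<Rightarrow> 'u"
    and q :: "'u \<Rightarrow> 's \<Rightarrow> 'u \<Rightarrow> 'u" +
  fixes N :: "('s, 'f, 'r, 'u) struct"
  assumes N_struc: "structure_of \<theta> \<Sigma> N"
    and q_hom: "i \<in> P \<Longrightarrow> homomorphism \<Sigma> (M i) N (q i)"
    and surj: "s \<in> sorts \<Sigma> \<Longrightarrow> x \<in> carr N s \<Longrightarrow> \<exists>i\<in>P. x \<in> q i s ` carr (M i) s"
    and rel_reflect: "i \<in> P \<Longrightarrow> R \<in> rels \<Sigma> \<Longrightarrow> a \<in> tuples (rargs \<Sigma> R) (rsort \<Sigma> R) (M i) \<Longrightarrow>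
      tmap (rargs \<Sigma> R) (rsort \<Sigma> R) (q i) a \<in> rint N R \<Longrightarrow>
      \<exists>k. (i, k) \<in> r \<and> tmap (rargs \<Sigma> R) (rsort \<Sigma> R) (h i k) a \<in> rint (M k) R"
begin

lemma N_tuple_stage:
  assumes "|Q| <o lam" and "\<sigma> ` Q \<subseteq> sorts \<Sigma>" and "t \<in> tuples Q \<sigma> N"
  obtains i a where "i \<in> P" and "a \<in> tuples Q \<sigma> (M i)" and "t = tmap Q \<sigma> (q i) a"
proof (rule tuple_stage[OF assms(1,2) tuples_ext[OF assms(3)]])
  show "\<exists>i\<in>P. t p \<in> q i (\<sigma> p) ` carr (M i) (\<sigma> p)" if "p \<in> Q" for p
    using surj tuplesD[OF assms(3) that] that assms(2) by blast
qed (rule that)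

text \<open>
  For a conjunction, a common bound of the stages of the conjuncts is needed; this is where the
  bound on the size of conjunctions enters.
\<close>

lemma sat_reflect:
  assumes "wf_form \<theta> lam \<Sigma> X \<Gamma> \<phi>" and X: "\<Gamma> ` X \<subseteq> sorts \<Sigma>" and i: "i \<in> P"
    and v: "v \<in> tuples X \<Gamma> (M i)" and "sat \<Sigma> N (tmap X \<Gamma> (q i) v) \<phi>"
  shows "\<exists>k. (i, k) \<in> r \<and> sat \<Sigma> (M k) (tmap X \<Gamma> (h i k) v) \<phi>"
  using assms(1,5)
proof induction
  case (1 t s t')
  have "q i s (eval \<Sigma> (M i) v t) = q i s (eval \<Sigma> (M i) v t')"
    using 1 eval_hom[OF _ M_struc[OF i] q_hom[OF i] X v] by simp
  then obtain k where "(i, k) \<in> r" "h i k s (eval \<Sigma> (M i) v t) = h i k s (eval \<Sigma> (M i) v t')"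
    using eq_reflect[OF i] eval_sort[OF 1(1) M_struc[OF i] X v] eval_sort[OF 1(2) M_struc[OF i] X v] by blast
  then show ?case
    using eval_hom[OF 1(1) M_struc[OF i] map_hom X v] eval_hom[OF 1(2) M_struc[OF i] map_hom X v]
    by auto
next
  case (2 R t)
  let ?a = "\<lambda>p\<in>rargs \<Sigma> R. eval \<Sigma> (M i) v (t p)"
  have "rmap \<Sigma> R (q i) ?a \<in> rint N R"
    using 2(3) Rel_args_hom[OF 2(2) M_struc[OF i] q_hom[OF i] X v] by simp
  then obtain k where k: "(i, k) \<in> r" "rmap \<Sigma> R (h i k) ?a \<in> rint (M k) R"
    using rel_reflect[OF i 2(1) Rel_args_tuple[OF 2(2) M_struc[OF i] X v]] by blast
  then show ?case
    using Rel_args_hom[OF 2(2) M_struc[OF i] map_hom[OF k(1)] X v] by auto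
next
  case (3 I \<phi>)
  then have "\<forall>c\<in>I. \<exists>k. (i, k) \<in> r \<and> sat \<Sigma> (M k) (tmap X \<Gamma> (h i k) v) (\<phi> c)" by simp
  then obtain g where g: "\<And>c. c \<in> I \<Longrightarrow> (i, g c) \<in> r \<and> sat \<Sigma> (M (g c)) (tmap X \<Gamma> (h i (g c)) v) (\<phi> c)"
    by metis
  have "g ` I \<subseteq> P" using g r_in by blast
  then obtain k where k: "(i, k) \<in> r" "\<And>c. c \<in> I \<Longrightarrow> (g c, k) \<in> r"
    using upper_family[OF 3(1) _ i] by metis
  have "sat \<Sigma> (M k) (tmap X \<Gamma> (h i k) v) (\<phi> c)" if c: "c \<in> I" for c
  proof -
    have ig: "(i, g c) \<in> r" using g c by blast
    have "sat \<Sigma> (M k) (tmap X \<Gamma> (h (g c) k) (tmap X \<Gamma> (h i (g c)) v)) (\<phi> c)"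
      using sat_hom[OF 3(2)[OF c] M_struc map_hom[OF k(2)[OF c]] X map_tuples[OF ig X v]]
        g[OF c] r_in by blast
    then show ?thesis using tmap_comp[OF ig k(2)[OF c] X v] by simp
  qed
  then show ?case using k(1) by auto
next
  case (4 I \<phi>)
  then obtain c where "c \<in> I" "sat \<Sigma> N (tmap X \<Gamma> (q i) v) (\<phi> c)" by auto
  then show ?case using 4(3) by fastforce
qed

text \<open>
  A valuation comes from a stage; if the premise of a sentence holds in the colimit, it holds at a
  later stage, hence so does the conclusion, which is preserved by the map into the colimit.
\<close>

lemma N_model: "N \<in> Ob \<M>"
proof -
  have "holds \<Sigma> N \<sigma>" if T: "\<sigma> \<in> T" for \<sigma>
  proof (cases \<sigma>)
    case (All_Imp X \<Gamma> \<phi> \<psi>)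
    note wf = theory_wf[OF T[unfolded All_Imp]]
    have "sat \<Sigma> N v \<psi>" if v: "v \<in> tuples X \<Gamma> N" and s: "sat \<Sigma> N v \<phi>" for v
    proof -
      obtain i w where i: "i \<in> P" and w: "w \<in> tuples X \<Gamma> (M i)" "v = tmap X \<Gamma> (q i) w"
        using N_tuple_stage[OF wf(1,2) v] .
      obtain k where k: "(i, k) \<in> r" "sat \<Sigma> (M k) (tmap X \<Gamma> (h i k) w) \<phi>"
        using sat_reflect[OF wf(3,2) i w(1)] s w(2) by blast
      have kP: "k \<in> P" using r_in k(1) by blast
      have wk: "tmap X \<Gamma> (h i k) w \<in> tuples X \<Gamma> (M k)" using map_tuples[OF k(1) wf(2) w(1)] .
      have "holds \<Sigma> (M k) (All_Imp X \<Gamma> \<phi> \<psi>)"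
        using model[OF kP] T unfolding All_Imp Mod_sel(1) by blast
      then have "sat \<Sigma> (M k) (tmap X \<Gamma> (h i k) w) \<psi>"
        using wk k(2) by (simp add: tuples_def)
      then have "sat \<Sigma> N (tmap X \<Gamma> (q k) (tmap X \<Gamma> (h i k) w)) \<psi>"
        using sat_hom[OF wf(4) M_struc[OF kP] q_hom[OF kP] wf(2) wk] by blast
      then show ?thesis using q_tmap_comp[OF k(1) wf(2) w(1)] w(2) by simp
    qed
    then show ?thesis using All_Imp by (simp add: tuples_def)
  qed
  then show ?thesis using N_struc by (simp add: Mod_sel(1))
qed

lemma homs_eqI:
  assumes "homo N K f" and "homo N L g"
    and "\<And>i s a. i \<in> P \<Longrightarrow> s \<in> sorts \<Sigma> \<Longrightarrow> a \<in> carr (M i) s \<Longrightarrow> f s (q i s a) = g s (q i s a)"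
  shows "f = g"
  by (rule hom_eqI[OF assms(1,2)]) (use surj assms(3) in blast)

text \<open>
  Values are prescribed on elements of stages, consistently because equal elements have the same germ.
  Compatibility with operations and relations can be checked on tuples from one stage.
\<close>

lemma mediating_hom:
  assumes d_hom: "\<And>i. i \<in> P \<Longrightarrow> homo (M i) K (d i)"
    and d_comp: "\<And>i j s a. (i, j) \<in> r \<Longrightarrow> s \<in> sorts \<Sigma> \<Longrightarrow> a \<in> carr (M i) s \<Longrightarrow>
      d j s (h i j s a) = d i s a"
  obtains k where "homo N K k"
    and "\<And>i s a. i \<in> P \<Longrightarrow> s \<in> sorts \<Sigma> \<Longrightarrow> a \<in> carr (M i) s \<Longrightarrow> k s (q i s a) = d i s a"
proof -
  have wd: "d i s a = d j s b"
    if "i \<in> P" "j \<in> P" "s \<in> sorts \<Sigma>" "a \<in> carr (M i) s" "b \<in> carr (M j) s" "q i s a = q j s b"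
    for i j s a b
    using eq_reflect2[OF that] d_comp that by metis
  have "\<exists>z. \<forall>i a. i \<in> P \<longrightarrow> a \<in> carr (M i) s \<longrightarrow> x = q i s a \<longrightarrow> z = d i s a" if "s \<in> sorts \<Sigma>" for s x
    using wd that by (cases "\<exists>i a. i \<in> P \<and> a \<in> carr (M i) s \<and> x = q i s a") metis+
  then obtain z where z: "\<And>i s a. i \<in> P \<Longrightarrow> s \<in> sorts \<Sigma> \<Longrightarrow> a \<in> carr (M i) s \<Longrightarrow> z s (q i s a) = d i s a"
    by metis
  define k where "k = (\<lambda>s\<in>sorts \<Sigma>. \<lambda>x\<in>carr N s. z s x)"
  have k: "k s (q i s a) = d i s a" if "i \<in> P" "s \<in> sorts \<Sigma>" "a \<in> carr (M i) s" for i s a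
    using z[OF that] hom_carr[OF q_hom[OF that(1)] that(2,3)] that(2) by (simp add: k_def)
  have kt: "tmap Q \<sigma> k (tmap Q \<sigma> (q i) a) = tmap Q \<sigma> (d i) a"
    if "i \<in> P" "\<sigma> ` Q \<subseteq> sorts \<Sigma>" "a \<in> tuples Q \<sigma> (M i)" for Q \<sigma> i a
    unfolding tmap_tmap by (rule tmap_cong) (use k[OF that(1)] tuplesD[OF that(3)] that(2) in auto)
  have "homo N K k"
  proof (rule homI)
    show "k \<in> (\<Pi>\<^sub>E s\<in>sorts \<Sigma>. carr N s \<rightarrow>\<^sub>E carr K s)"
    proof (rule PiE_I)
      fix s assume s: "s \<in> sorts \<Sigma>"
      show "k s \<in> carr N s \<rightarrow>\<^sub>E carr K s"
      proof (rule PiE_I)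
        fix x assume "x \<in> carr N s"
        then obtain i a where "i \<in> P" "a \<in> carr (M i) s" "x = q i s a" using surj[OF s] by blast
        then show "k s x \<in> carr K s" using k s hom_carr[OF d_hom] by simp
      qed (simp add: k_def s)
    qed (simp add: k_def)
  next
    fix f t assume f: "f \<in> funs \<Sigma>" and t: "t \<in> ftup \<Sigma> f N"
    obtain i a where i: "i \<in> P" and a: "a \<in> ftup \<Sigma> f (M i)" and ta: "t = fmap \<Sigma> f (q i) a"
      using N_tuple_stage[OF fargs_lam[OF f] fsorts[OF f] t] .
    have "k (fres \<Sigma> f) (fint N f t) = k (fres \<Sigma> f) (q i (fres \<Sigma> f) (fint (M i) f a))"
      using hom_fint[OF q_hom[OF i] f a] ta by simp
    also have "\<dots> = d i (fres \<Sigma> f) (fint (M i) f a)"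
      using k[OF i fres_sort[OF f] struc_fint[OF M_struc[OF i] f a]] .
    also have "\<dots> = fint K f (fmap \<Sigma> f k t)"
      using hom_fint[OF d_hom[OF i] f a] kt[OF i fsorts[OF f] a] ta by simp
    finally show "k (fres \<Sigma> f) (fint N f t) = fint K f (fmap \<Sigma> f k t)" .
  next
    fix R t assume R: "R \<in> rels \<Sigma>" and t: "t \<in> rint N R"
    obtain i a where i: "i \<in> P" and a: "a \<in> rtup \<Sigma> R (M i)" and ta: "t = rmap \<Sigma> R (q i) a"
      using N_tuple_stage[OF rargs_lam[OF R] rsorts[OF R] struc_rint[OF N_struc R t]] .
    obtain l where l: "(i, l) \<in> r" "rmap \<Sigma> R (h i l) a \<in> rint (M l) R"
      using rel_reflect[OF i R a] t ta by blast
    have lP: "l \<in> P" using l r_in by blast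
    have "rmap \<Sigma> R (d l) (rmap \<Sigma> R (h i l) a) \<in> rint K R"
      using hom_rint[OF d_hom[OF lP] R l(2)] .
    also have "rmap \<Sigma> R (d l) (rmap \<Sigma> R (h i l) a) = rmap \<Sigma> R k t"
      using kt[OF lP rsorts[OF R] map_tuples[OF l(1) rsorts[OF R] a]]
        q_tmap_comp[OF l(1) rsorts[OF R] a] ta by simp
    finally show "rmap \<Sigma> R k t \<in> rint K R" .
  qed
  then show thesis using that k by blast
qed

end

context separated_cocone
begin

text \<open>
  The value of an operation is computed at any stage that represents the arguments;
  \<open>colim_fint\<close> shows that the choice does not matter.
\<close>

definition colim :: "('s, 'f, 'r, 'u) struct" where
  "colim =
    \<lparr>carr = (\<lambda>s. \<Union>i\<in>P. q i s ` carr (M i) s),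
     fint = (\<lambda>f. \<lambda>t\<in>(\<Pi>\<^sub>E p\<in>fargs \<Sigma> f. \<Union>i\<in>P. q i (fsort \<Sigma> f p) ` carr (M i) (fsort \<Sigma> f p)).
       SOME z. \<exists>i\<in>P. \<exists>a\<in>ftup \<Sigma> f (M i). t = fmap \<Sigma> f (q i) a \<and> z = q i (fres \<Sigma> f) (fint (M i) f a)),
     rint = (\<lambda>R. \<Union>i\<in>P. rmap \<Sigma> R (q i) ` rint (M i) R)\<rparr>"

lemma colim_carr: "carr colim s = (\<Union>i\<in>P. q i s ` carr (M i) s)"
  and colim_rint: "rint colim R = (\<Union>i\<in>P. rmap \<Sigma> R (q i) ` rint (M i) R)"
  by (simp_all add: colim_def)

lemma q_colim_tuples: "i \<in> P \<Longrightarrow> a \<in> tuples Q \<sigma> (M i) \<Longrightarrow> tmap Q \<sigma> (q i) a \<in> tuples Q \<sigma> colim"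
  by (rule tuplesI) (use tuplesD[of a Q \<sigma> "M i"] in \<open>auto simp: colim_carr\<close>)

text \<open>
  Two representing stages agree at a later one, because equal tuples become equal at a later stage.
\<close>

lemma colim_fint:
  assumes f: "f \<in> funs \<Sigma>" and i: "i \<in> P" and a: "a \<in> ftup \<Sigma> f (M i)"
  shows "fint colim f (fmap \<Sigma> f (q i) a) = q i (fres \<Sigma> f) (fint (M i) f a)"
proof -
  have wd: "q j (fres \<Sigma> f) (fint (M j) f b) = q i (fres \<Sigma> f) (fint (M i) f a)"
    if j: "j \<in> P" and b: "b \<in> ftup \<Sigma> f (M j)" and eq: "fmap \<Sigma> f (q i) a = fmap \<Sigma> f (q j) b" for j b
  proof -
    obtain k where k: "(i, k) \<in> r" "(j, k) \<in> r" "fmap \<Sigma> f (h i k) a = fmap \<Sigma> f (h j k) b"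
      using tuple_eq_reflect[OF fargs_lam[OF f] fsorts[OF f] i j a b eq] .
    then have "h i k (fres \<Sigma> f) (fint (M i) f a) = h j k (fres \<Sigma> f) (fint (M j) f b)"
      using hom_fint[OF map_hom[OF k(1)] f a] hom_fint[OF map_hom[OF k(2)] f b] by simp
    then show ?thesis
      using q_comp[OF k(1) fres_sort[OF f] struc_fint[OF M_struc[OF i] f a]]
        q_comp[OF k(2) fres_sort[OF f] struc_fint[OF M_struc[OF j] f b]] by simp
  qed
  have "fmap \<Sigma> f (q i) a \<in> (\<Pi>\<^sub>E p\<in>fargs \<Sigma> f. \<Union>i\<in>P. q i (fsort \<Sigma> f p) ` carr (M i) (fsort \<Sigma> f p))"
    using q_colim_tuples[OF i a] by (simp add: tuples_def colim_carr)
  then have "fint colim f (fmap \<Sigma> f (q i) a) = (SOME z. \<exists>j\<in>P. \<exists>b\<in>ftup \<Sigma> f (M j).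
      fmap \<Sigma> f (q i) a = fmap \<Sigma> f (q j) b \<and> z = q j (fres \<Sigma> f) (fint (M j) f b))"
    by (simp add: colim_def)
  also have "\<dots> = q i (fres \<Sigma> f) (fint (M i) f a)"
    by (rule some_equality) (use i a wd in blast)+
  finally show ?thesis .
qed

lemma colim_tuple_stage:
  assumes "|Q| <o lam" and "\<sigma> ` Q \<subseteq> sorts \<Sigma>" and "t \<in> tuples Q \<sigma> colim"
  obtains i a where "i \<in> P" and "a \<in> tuples Q \<sigma> (M i)" and "t = tmap Q \<sigma> (q i) a"
proof (rule tuple_stage[OF assms(1,2) tuples_ext[OF assms(3)]])
  show "\<exists>i\<in>P. t p \<in> q i (\<sigma> p) ` carr (M i) (\<sigma> p)" if "p \<in> Q" for p
    using tuplesD[OF assms(3) that] by (auto simp: colim_carr)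
qed (rule that)

lemma colim_struc: "struc colim"
  unfolding structure_of_def
proof (intro conjI ballI)
  fix s assume s: "s \<in> sorts \<Sigma>"
  have "|q i s ` carr (M i) s| <o \<theta>" if "i \<in> P" for i
    using M_struc[OF that] s card_of_image ordLeq_ordLess_trans
    unfolding structure_of_def small_def by blast
  then show "small \<theta> (carr colim s)"
    unfolding colim_carr small_def
    by (rule regularCard_UNION_bound[OF theta_inf theta_reg small_P[unfolded small_def]])
next
  fix f assume f: "f \<in> funs \<Sigma>"
  show "fint colim f \<in> fun_tuples \<Sigma> colim f \<rightarrow>\<^sub>E carr colim (fres \<Sigma> f)"
  proof (rule PiE_I)
    fix t assume "t \<in> fun_tuples \<Sigma> colim f"
    then have t: "t \<in> ftup \<Sigma> f colim" by (simp add: fun_tuples_def tuples_def)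
    obtain i a where i: "i \<in> P" and a: "a \<in> ftup \<Sigma> f (M i)" and ta: "t = fmap \<Sigma> f (q i) a"
      using colim_tuple_stage[OF fargs_lam[OF f] fsorts[OF f] t] .
    show "fint colim f t \<in> carr colim (fres \<Sigma> f)"
      using colim_fint[OF f i a] ta struc_fint[OF M_struc[OF i] f a] i by (auto simp: colim_carr)
  next
    fix t assume "t \<notin> fun_tuples \<Sigma> colim f"
    then show "fint colim f t = undefined" by (simp add: fun_tuples_def colim_carr) (simp add: colim_def)
  qed
next
  fix R assume R: "R \<in> rels \<Sigma>"
  have "rmap \<Sigma> R (q i) a \<in> rel_tuples \<Sigma> colim R" if i: "i \<in> P" and a: "a \<in> rint (M i) R" for i a
    using q_colim_tuples[OF i struc_rint[OF M_struc[OF i] R a]] by (simp add: rel_tuples_def tuples_def)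
  then show "rint colim R \<subseteq> rel_tuples \<Sigma> colim R" by (auto simp: colim_rint)
qed

lemma colim_concrete:
  assumes ext: "\<And>i. i \<in> P \<Longrightarrow> q i \<in> extensional (sorts \<Sigma>)"
    "\<And>i s. i \<in> P \<Longrightarrow> s \<in> sorts \<Sigma> \<Longrightarrow> q i s \<in> extensional (carr (M i) s)"
  shows "concrete_colimit \<theta> lam \<kappa> \<Sigma> T P r M h q colim"
proof unfold_locales
  show "struc colim" by (rule colim_struc)
next
  fix i assume i: "i \<in> P"
  show "homo (M i) colim (q i)"
  proof (rule homI)
    show "q i \<in> (\<Pi>\<^sub>E s\<in>sorts \<Sigma>. carr (M i) s \<rightarrow>\<^sub>E carr colim s)"
      using ext i by (auto simp: PiE_def colim_carr)
    show "q i (fres \<Sigma> f) (fint (M i) f a) = fint colim f (fmap \<Sigma> f (q i) a)"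
      if "f \<in> funs \<Sigma>" "a \<in> ftup \<Sigma> f (M i)" for f a
      using colim_fint[OF that(1) i that(2)] by simp
    show "rmap \<Sigma> R (q i) a \<in> rint colim R" if "R \<in> rels \<Sigma>" "a \<in> rint (M i) R" for R a
      using i that by (auto simp: colim_rint)
  qed
next
  show "\<exists>i\<in>P. x \<in> q i s ` carr (M i) s" if "x \<in> carr colim s" for s x
    using that by (simp add: colim_carr)
next
  fix i R a
  assume i: "i \<in> P" and R: "R \<in> rels \<Sigma>" and a: "a \<in> rtup \<Sigma> R (M i)"
    and "rmap \<Sigma> R (q i) a \<in> rint colim R"
  then obtain j b where j: "j \<in> P" and b: "b \<in> rint (M j) R" and eq: "rmap \<Sigma> R (q i) a = rmap \<Sigma> R (q j) b"
    by (auto simp: colim_rint)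
  obtain k where k: "(i, k) \<in> r" "(j, k) \<in> r" "rmap \<Sigma> R (h i k) a = rmap \<Sigma> R (h j k) b"
    using tuple_eq_reflect[OF rargs_lam[OF R] rsorts[OF R] i j a struc_rint[OF M_struc[OF j] R b] eq] .
  then show "\<exists>k. (i, k) \<in> r \<and> rmap \<Sigma> R (h i k) a \<in> rint (M k) R"
    using hom_rint[OF map_hom[OF k(2)] R b] by metis
qed

end

context directed_models
begin

definition germ where
  "germ s i a j b \<longleftrightarrow> (\<exists>k. (i, k) \<in> r \<and> (j, k) \<in> r \<and> h i k s a = h j k s b)"

lemma germ_sym: "germ s i a j b \<Longrightarrow> germ s j b i a"
  by (auto simp: germ_def)

lemma germ_trans:
  assumes s: "s \<in> sorts \<Sigma>" and a: "a \<in> carr (M i) s" and b: "b \<in> carr (M j) s" and c: "c \<in> carr (M l) s"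
    and ab: "germ s i a j b" and bc: "germ s j b l c"
  shows "germ s i a l c"
proof -
  obtain m where m: "(i, m) \<in> r" "(j, m) \<in> r" "h i m s a = h j m s b" using ab by (auto simp: germ_def)
  obtain n where n: "(j, n) \<in> r" "(l, n) \<in> r" "h j n s b = h l n s c" using bc by (auto simp: germ_def)
  obtain k where k: "(m, k) \<in> r" "(n, k) \<in> r" using upper2[of m n] m n r_in by metis
  have "h i k s a = h j k s b"
    using map_comp[OF m(1) k(1) s a] map_comp[OF m(2) k(1) s b] m(3) by simp
  also have "\<dots> = h l k s c"
    using map_comp[OF n(1) k(2) s b] map_comp[OF n(2) k(2) s c] n(3) by simp
  finally show ?thesis unfolding germ_def using r_trans m(1) n(2) k by blast
qed

text \<open>
  Germs are encoded by chosen representatives; an injection from pairs makes them elements of the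
  type in which carriers of structures live.
\<close>

lemma ex_separated_cocone:
  obtains q where "separated_cocone \<theta> lam \<kappa> \<Sigma> T P r M h q"
    and "\<And>i. i \<in> P \<Longrightarrow> q i \<in> extensional (sorts \<Sigma>)"
    and "\<And>i s. i \<in> P \<Longrightarrow> s \<in> sorts \<Sigma> \<Longrightarrow> q i s \<in> extensional (carr (M i) s)"
proof -
  have "infinite (UNIV :: 'u set)"
    using theta_inf finite_subset[OF subset_UNIV] by (auto simp: cinfinite_def)
  then have "|(UNIV :: 'u set) \<times> (UNIV :: 'u set)| \<le>o |UNIV :: 'u set|"
    using card_of_Times_same_infinite ordIso_imp_ordLeq by blast
  then obtain e :: "'u \<times> 'u \<Rightarrow> 'u" where e: "inj e"
    unfolding card_of_ordLeq[symmetric] by auto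
  define C where "C s i a = {(j, b). j \<in> P \<and> b \<in> carr (M j) s \<and> germ s i a j b}" for s i a
  define q where "q i = (\<lambda>s\<in>sorts \<Sigma>. \<lambda>a\<in>carr (M i) s. e (SOME p. p \<in> C s i a))" for i
  have C_self: "(i, a) \<in> C s i a" if "i \<in> P" "a \<in> carr (M i) s" for s i a
    using that r_refl by (auto simp: C_def germ_def)
  have C_some: "(SOME p. p \<in> C s i a) \<in> C s i a" if "i \<in> P" "a \<in> carr (M i) s" for s i a
    using C_self[OF that] by (rule someI)
  have C_eq: "C s i a = C s j b"
    if "s \<in> sorts \<Sigma>" "a \<in> carr (M i) s" "b \<in> carr (M j) s" "germ s i a j b" for s i a j b
    using germ_trans that germ_sym unfolding C_def by blast
  have "separated_cocone \<theta> lam \<kappa> \<Sigma> T P r M h q"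
  proof unfold_locales
    fix i j s a assume ij: "(i, j) \<in> r" and s: "s \<in> sorts \<Sigma>" and a: "a \<in> carr (M i) s"
    have "germ s j (h i j s a) i a"
      unfolding germ_def using ij r_refl r_in map_id[OF _ s map_carr[OF ij s a]] by blast
    then show "q j s (h i j s a) = q i s a"
      using C_eq[OF s map_carr[OF ij s a] a] map_carr[OF ij s a] s a by (simp add: q_def)
  next
    fix i s a b
    assume i: "i \<in> P" and s: "s \<in> sorts \<Sigma>" and a: "a \<in> carr (M i) s" and b: "b \<in> carr (M i) s"
      and eq: "q i s a = q i s b"
    have "(SOME p. p \<in> C s i a) = (SOME p. p \<in> C s i b)"
      using eq s a b injD[OF e] by (simp add: q_def)
    then obtain j c where "(j, c) \<in> C s i a" "(j, c) \<in> C s i b"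
      using C_some[OF i a] C_some[OF i b] by (metis surj_pair)
    then have "germ s i a i b"
      using germ_trans[OF s a _ b, of c j] germ_sym by (auto simp: C_def)
    then show "\<exists>k. (i, k) \<in> r \<and> h i k s a = h i k s b" by (auto simp: germ_def)
  qed
  then show thesis by (rule that) (auto simp: q_def)
qed

lemma ex_concrete_colimit: "\<exists>q N. concrete_colimit \<theta> lam \<kappa> \<Sigma> T P r M h q N"
  using ex_separated_cocone separated_cocone.colim_concrete by metis

text \<open>
  The components of a functor are total functions, so a diagram is compared with the models and
  maps only on the index poset.
\<close>

definition presents where
  "presents D \<longleftrightarrow> (\<forall>i\<in>P. obj D i = M i) \<and> (\<forall>(i, j)\<in>r. arr D (i, j) = (M i, h i j, M j))"

abbreviation um :: "('s, 'f, 'r, 'u) struct \<times> ('s \<Rightarrow> 'u \<Rightarrow> 'u) \<times> ('s, 'f, 'r, 'u) struct \<Rightarrow> 's \<Rightarrow> 'u \<Rightarrow> 'u" where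
  "um c \<equiv> fst (snd c)"

lemma cocone_Mod_iff:
  assumes D: "presents D"
  shows "cocone (poset_cat P r) \<M> D K d \<longleftrightarrow> K \<in> Ob \<M> \<and>
    (\<forall>i\<in>P. d i = (M i, um (d i), K) \<and> homo (M i) K (um (d i))) \<and>
    (\<forall>i j s a. (i, j) \<in> r \<longrightarrow> s \<in> sorts \<Sigma> \<longrightarrow> a \<in> carr (M i) s \<longrightarrow> um (d j) s (h i j s a) = um (d i) s a)"
    (is "?L \<longleftrightarrow> ?K \<and> ?H \<and> ?C")
proof -
  have 1: "(\<forall>i\<in>P. d i \<in> hom \<M> (obj D i) K) \<longleftrightarrow> ?H" if ?K
    using D that model by (auto simp: presents_def Mod_hom)
  have 2: "Cmp \<M> (d j) (arr D (i, j)) = d i \<longleftrightarrow>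
      (\<forall>s a. s \<in> sorts \<Sigma> \<longrightarrow> a \<in> carr (M i) s \<longrightarrow> um (d j) s (h i j s a) = um (d i) s a)"
    if H: ?H and ij: "(i, j) \<in> r" for i j
  proof -
    have i: "i \<in> P" and j: "j \<in> P" using ij r_in by auto
    obtain f g where f: "d i = (M i, f, K)" "homo (M i) K f" and g: "d j = (M j, g, K)" "homo (M j) K g"
      using H i j by metis
    have gh: "homo (M i) K (hcomp \<Sigma> (M i) g (h i j))"
      using homo_comp[OF M_struc[OF i] map_hom[OF ij] g(2)] .
    have "Cmp \<M> (d j) (arr D (i, j)) = d i \<longleftrightarrow> hcomp \<Sigma> (M i) g (h i j) = f"
      using D ij by (auto simp: presents_def f(1) g(1) Mod_sel(6))
    also have "\<dots> \<longleftrightarrow> (\<forall>s a. s \<in> sorts \<Sigma> \<longrightarrow> a \<in> carr (M i) s \<longrightarrow> g s (h i j s a) = f s a)"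
      using hom_eqI[OF gh f(2)] by auto
    finally show ?thesis by (simp add: f(1) g(1))
  qed
  have "?L \<longleftrightarrow> ?K \<and> ?H \<and> (\<forall>i j. (i, j) \<in> r \<longrightarrow> Cmp \<M> (d j) (arr D (i, j)) = d i)"
    using 1 by (auto simp: cocone_def poset_cat_def)
  then show ?thesis using 2 by blast
qed

end

theorem (in concrete_colimit) colimit_in_Mod:
  assumes D: "presents D" and c: "\<And>i. i \<in> P \<Longrightarrow> c i = (M i, q i, N)"
  shows "colimit_cocone (poset_cat P r) \<M> D N c"
  unfolding colimit_cocone_def
proof (intro conjI allI impI)
  show "cocone (poset_cat P r) \<M> D N c"
    unfolding cocone_Mod_iff[OF D] using c N_model q_hom q_comp r_in by simp
next
  fix K d assume "cocone (poset_cat P r) \<M> D K d"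
  then have K: "K \<in> Ob \<M>" and d: "\<And>i. i \<in> P \<Longrightarrow> d i = (M i, um (d i), K)"
    and dh: "\<And>i. i \<in> P \<Longrightarrow> homo (M i) K (um (d i))"
    and dc: "\<And>i j s a. (i, j) \<in> r \<Longrightarrow> s \<in> sorts \<Sigma> \<Longrightarrow> a \<in> carr (M i) s \<Longrightarrow>
      um (d j) s (h i j s a) = um (d i) s a"
    unfolding cocone_Mod_iff[OF D] by blast+
  have comp: "Cmp \<M> (N, k, K) (c i) = d i \<longleftrightarrow>
      (\<forall>s a. s \<in> sorts \<Sigma> \<longrightarrow> a \<in> carr (M i) s \<longrightarrow> k s (q i s a) = um (d i) s a)"
    if i: "i \<in> P" and k: "homo N K k" for i k
  proof -
    have "Cmp \<M> (N, k, K) (c i) = d i \<longleftrightarrow> hcomp \<Sigma> (M i) k (q i) = um (d i)"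
      using c[OF i] d[OF i] by (metis Mod_sel(6) fst_conv snd_conv)
    also have "\<dots> \<longleftrightarrow> (\<forall>s a. s \<in> sorts \<Sigma> \<longrightarrow> a \<in> carr (M i) s \<longrightarrow> k s (q i s a) = um (d i) s a)"
      using hom_eqI[OF homo_comp[OF M_struc[OF i] q_hom[OF i] k] dh[OF i]] by (metis hcomp_apply)
    finally show ?thesis .
  qed
  obtain k where k: "homo N K k"
    and kq: "\<And>i s a. i \<in> P \<Longrightarrow> s \<in> sorts \<Sigma> \<Longrightarrow> a \<in> carr (M i) s \<Longrightarrow> k s (q i s a) = um (d i) s a"
    using mediating_hom[OF dh dc] by blast
  show "\<exists>!u. u \<in> hom \<M> N K \<and> (\<forall>i\<in>Ob (poset_cat P r). Cmp \<M> u (c i) = d i)"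
  proof (rule ex1I)
    show "(N, k, K) \<in> hom \<M> N K \<and> (\<forall>i\<in>Ob (poset_cat P r). Cmp \<M> (N, k, K) (c i) = d i)"
      using k kq comp K N_model by (auto simp: Mod_hom poset_cat_def)
  next
    fix u assume u: "u \<in> hom \<M> N K \<and> (\<forall>i\<in>Ob (poset_cat P r). Cmp \<M> u (c i) = d i)"
    then obtain k' where k': "u = (N, k', K)" "homo N K k'" by (auto simp: Mod_hom)
    have "k' = k"
      using u comp[OF _ k'(2)] kq by (intro homs_eqI[OF k'(2) k]) (simp add: k'(1) poset_cat_def)
    then show "u = (N, k, K)" using k'(1) by simp
  qed
qed

text \<open>
  The colimit \<open>K\<close> is compared with a concrete colimit \<open>N\<close> of the same diagram.  The homomorphism from
  \<open>K\<close> to \<open>N\<close> pulls back coincidences to stages, and the one from \<open>N\<close> to \<open>K\<close> is inverse to it on the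
  left, so every element of \<open>K\<close> comes from a stage.
\<close>

theorem (in directed_models) colimit_concrete:
  assumes D: "presents D" and colim: "colimit_cocone (poset_cat P r) \<M> D K c"
  shows "concrete_colimit \<theta> lam \<kappa> \<Sigma> T P r M h (\<lambda>i. um (c i)) K"
proof -
  obtain q N where "concrete_colimit \<theta> lam \<kappa> \<Sigma> T P r M h q N" using ex_concrete_colimit by blast
  then interpret L: concrete_colimit \<theta> lam \<kappa> \<Sigma> T P r M h q N .
  have "cocone (poset_cat P r) \<M> D K c" using colim by (simp add: colimit_cocone_def)
  then have K: "K \<in> Ob \<M>" and c: "\<And>i. i \<in> P \<Longrightarrow> c i = (M i, um (c i), K)"
    and ch: "\<And>i. i \<in> P \<Longrightarrow> homo (M i) K (um (c i))"
    and cc: "\<And>i j s a. (i, j) \<in> r \<Longrightarrow> s \<in> sorts \<Sigma> \<Longrightarrow> a \<in> carr (M i) s \<Longrightarrow>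
      um (c j) s (h i j s a) = um (c i) s a"
    unfolding cocone_Mod_iff[OF D] by blast+
  have Ks: "struc K" using K by (rule model_struc)
  have "cocone (poset_cat P r) \<M> D N (\<lambda>i. (M i, q i, N))"
    unfolding cocone_Mod_iff[OF D] using L.N_model L.q_hom L.q_comp by simp
  then have "\<exists>!u. u \<in> hom \<M> K N \<and> (\<forall>i\<in>Ob (poset_cat P r). Cmp \<M> u (c i) = (M i, q i, N))"
    using colim unfolding colimit_cocone_def by blast
  then obtain u where u: "u \<in> hom \<M> K N \<and> (\<forall>i\<in>Ob (poset_cat P r). Cmp \<M> u (c i) = (M i, q i, N))"
    by (elim ex1E)
  then have uc: "Cmp \<M> u (c i) = (M i, q i, N)" if "i \<in> P" for i using that by simp
  obtain g where g: "u = (K, g, N)" "homo K N g" using u by (auto simp: Mod_hom)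
  have gc: "g s (um (c i) s a) = q i s a" if "i \<in> P" "s \<in> sorts \<Sigma>" "a \<in> carr (M i) s" for i s a
  proof -
    have "hcomp \<Sigma> (M i) g (um (c i)) = q i"
      using uc[OF that(1)] c[OF that(1)] g(1) by (metis Mod_sel(6) fst_conv snd_conv)
    then show ?thesis using hcomp_apply[OF that(2,3)] by metis
  qed
  obtain k where k: "homo N K k"
    and kq: "\<And>i s a. i \<in> P \<Longrightarrow> s \<in> sorts \<Sigma> \<Longrightarrow> a \<in> carr (M i) s \<Longrightarrow> k s (q i s a) = um (c i) s a"
    using L.mediating_hom[OF ch cc] by blast
  have kg: "homo K K (hcomp \<Sigma> K k g)" using homo_comp[OF Ks g(2) k] .
  have kgc: "Cmp \<M> (K, hcomp \<Sigma> K k g, K) (c i) = c i" if i: "i \<in> P" for i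
  proof -
    have "hcomp \<Sigma> (M i) (hcomp \<Sigma> K k g) (um (c i)) = um (c i)"
      by (rule hom_eqI[OF homo_comp[OF M_struc[OF i] ch[OF i] kg] ch[OF i]])
        (use hom_carr[OF ch[OF i]] gc[OF i] kq[OF i] in simp)
    then show ?thesis using c[OF i] by (metis Mod_sel(6))
  qed
  have idc: "Cmp \<M> (K, hid \<Sigma> K, K) (c i) = c i" if i: "i \<in> P" for i
  proof -
    have "hcomp \<Sigma> (M i) (hid \<Sigma> K) (um (c i)) = um (c i)"
      by (rule hom_eqI[OF homo_comp[OF M_struc[OF i] ch[OF i] homo_id[OF Ks]] ch[OF i]])
        (use hom_carr[OF ch[OF i]] in simp)
    then show ?thesis using c[OF i] by (metis Mod_sel(6))
  qed
  have "\<exists>!v. v \<in> hom \<M> K K \<and> (\<forall>i\<in>Ob (poset_cat P r). Cmp \<M> v (c i) = c i)"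
    using colim unfolding colimit_cocone_def by blast
  moreover have "(K, hcomp \<Sigma> K k g, K) \<in> hom \<M> K K" "(K, hid \<Sigma> K, K) \<in> hom \<M> K K"
    using K kg homo_id[OF Ks] by (auto simp: Mod_hom)
  ultimately have "(K, hcomp \<Sigma> K k g, K) = (K, hid \<Sigma> K, K)"
    using kgc idc unfolding poset_cat_simps by blast
  then have "hcomp \<Sigma> K k g = hid \<Sigma> K" by simp
  then have kgx: "k s (g s x) = x" if "s \<in> sorts \<Sigma>" "x \<in> carr K s" for s x
    using hcomp_apply[OF that] hid_apply[OF that] by metis
  show ?thesis
  proof unfold_locales
    show "um (c j) s (h i j s a) = um (c i) s a" if "(i, j) \<in> r" "s \<in> sorts \<Sigma>" "a \<in> carr (M i) s" for i j s a
      using cc that .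
    show "\<exists>k. (i, k) \<in> r \<and> h i k s a = h i k s b"
      if "i \<in> P" "s \<in> sorts \<Sigma>" "a \<in> carr (M i) s" "b \<in> carr (M i) s" "um (c i) s a = um (c i) s b" for i s a b
      using L.eq_reflect[OF that(1-4)] gc[OF that(1,2)] that(3-5) by metis
    show "struc K" by (rule Ks)
    show "homo (M i) K (um (c i))" if "i \<in> P" for i using ch[OF that] .
    show "\<exists>i\<in>P. x \<in> um (c i) s ` carr (M i) s" if s: "s \<in> sorts \<Sigma>" and x: "x \<in> carr K s" for s x
    proof -
      obtain i a where "i \<in> P" "a \<in> carr (M i) s" "g s x = q i s a"
        using L.surj[OF s hom_carr[OF g(2) s x]] by blast
      then show ?thesis using kgx[OF s x] kq s by (metis imageI)
    qed
    show "\<exists>k. (i, k) \<in> r \<and> rmap \<Sigma> R (h i k) a \<in> rint (M k) R"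
      if i: "i \<in> P" and R: "R \<in> rels \<Sigma>" and a: "a \<in> rtup \<Sigma> R (M i)" and x: "rmap \<Sigma> R (um (c i)) a \<in> rint K R"
      for i R a
    proof -
      have "rmap \<Sigma> R g (rmap \<Sigma> R (um (c i)) a) = rmap \<Sigma> R (q i) a"
        unfolding tmap_tmap by (rule tmap_cong) (use gc[OF i] tuplesD[OF a] R in auto)
      then show ?thesis using L.rel_reflect[OF i R a] hom_rint[OF g(2) R x] by simp
    qed
  qed
qed


section \<open>Generated objects\<close>

context category
begin

lemma cmp_assoc:
  assumes "f \<in> hom C a b" "g \<in> hom C b c" "h \<in> hom C c d"
  shows "Cmp C (Cmp C h g) f = Cmp C h (Cmp C g f)"
  using assoc[OF assms] by simp

lemma hom_Ob: "f \<in> hom C a b \<Longrightarrow> a \<in> Ob C \<and> b \<in> Ob C"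
  using dom_cod by (auto simp: hom_def)

lemma mono_cancel:
  assumes "mono_in C x" "x \<in> hom C b c" "f \<in> hom C a b" "g \<in> hom C a b" "Cmp C x f = Cmp C x g"
  shows "f = g"
  using assms hom_Ob[OF assms(3)] by (auto simp: mono_in_def hom_def)

end

locale mono_diagram = category C + directed_index lam P r
  for C :: "('o, 'm) cat" and lam :: "'l rel" and P :: "'u set" and r :: "'u rel" +
  fixes \<theta> :: "'u rel"
    and D :: "('u, 'u \<times> 'u, 'o, 'm) fctr" and X :: 'o and c :: "'u \<Rightarrow> 'm"
  assumes theta_inf: "Cinfinite \<theta>"
    and diagram: "directed_mono_diagram \<theta> lam C P r D"
    and colimit: "colimit_cocone (poset_cat P r) C D X c"
begin

lemma D_functor: "is_functor (poset_cat P r) C D"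
  using diagram by (simp add: directed_mono_diagram_def)

lemma D_arr: "(i, j) \<in> r \<Longrightarrow> arr D (i, j) \<in> hom C (obj D i) (obj D j)"
  using D_functor unfolding is_functor_def poset_cat_def by fastforce

lemma D_id: "i \<in> P \<Longrightarrow> arr D (i, i) = Idn C (obj D i)"
  using D_functor unfolding is_functor_def poset_cat_def by simp

lemma D_comp:
  assumes "(i, j) \<in> r" "(j, k) \<in> r"
  shows "Cmp C (arr D (j, k)) (arr D (i, j)) = arr D (i, k)"
proof -
  have "arr D (Cmp (poset_cat P r) (j, k) (i, j)) = Cmp C (arr D (j, k)) (arr D (i, j))"
    using D_functor assms r_in[OF assms(1)] r_in[OF assms(2)]
    unfolding is_functor_def by (simp add: poset_cat_def hom_def)
  then show ?thesis by (simp add: poset_cat_def)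
qed

lemma D_mono: "(i, j) \<in> r \<Longrightarrow> mono_in C (arr D (i, j))"
  using diagram by (simp add: directed_mono_diagram_def)

lemma c_hom: "i \<in> P \<Longrightarrow> c i \<in> hom C (obj D i) X"
  using colimit by (simp add: colimit_cocone_def cocone_def poset_cat_def)

lemma c_comp: "(i, j) \<in> r \<Longrightarrow> Cmp C (c j) (arr D (i, j)) = c i"
  using colimit by (fastforce simp: colimit_cocone_def cocone_def poset_cat_def)

lemma D_apply:
  assumes "(i, j) \<in> r" "(j, k) \<in> r" "g \<in> hom C G (obj D i)"
  shows "Cmp C (arr D (j, k)) (Cmp C (arr D (i, j)) g) = Cmp C (arr D (i, k)) g"
  using cmp_assoc[OF assms(3) D_arr[OF assms(1)] D_arr[OF assms(2)]] D_comp[OF assms(1,2)] by simp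

text \<open>
  The hom functor at a generated object sends the cocone to a colimit of sets.  Testing this colimit
  on maps to a set with two elements says that subsets of the hom-set into the colimit are the same
  as compatible families of subsets of the hom-sets into the stages.
\<close>

lemma generated_subsets:
  assumes G: "generated \<theta> lam C G"
    and V: "\<And>i j g. (i, j) \<in> r \<Longrightarrow> g \<in> hom C G (obj D i) \<Longrightarrow> Cmp C (arr D (i, j)) g \<in> V j \<longleftrightarrow> g \<in> V i"
  shows "\<exists>!W. W \<subseteq> hom C G X \<and> (\<forall>i\<in>P. \<forall>g\<in>hom C G (obj D i). Cmp C (c i) g \<in> W \<longleftrightarrow> g \<in> V i)"
proof -
  let ?H = "hom_functor C G :: ('o, 'm, ('u + 'm) set, ('u + 'm) set \<times> ('u + 'm \<Rightarrow> 'u + 'm) \<times> ('u + 'm) set) fctr"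
  let ?h = "\<lambda>Z. Inr ` hom C G Z :: ('u + 'm) set"
  obtain b0 b1 :: 'u where b: "b0 \<noteq> b1"
  proof -
    have "infinite (UNIV :: 'u set)"
      using theta_inf finite_subset[OF subset_UNIV] by (auto simp: cinfinite_def)
    then show thesis using that by (metis (full_types) UNIV_I finite.simps finite_subset insertCI subsetI)
  qed
  define B :: "('u + 'm) set" where "B = {Inl b0, Inl b1}"
  \<comment> \<open>\<open>chi Z W\<close> is the characteristic function of \<open>W\<close> as a map from the hom-set into \<open>Z\<close> to \<open>B\<close>\<close>
  define chi :: "'o \<Rightarrow> 'm set \<Rightarrow> ('u + 'm) set \<times> ('u + 'm \<Rightarrow> 'u + 'm) \<times> ('u + 'm) set"
    where "chi Z W = (?h Z, \<lambda>x\<in>?h Z. if projr x \<in> W then Inl b1 else Inl b0, B)" for Z W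
  have chi_eq: "chi Z W = chi Z W' \<longleftrightarrow> (\<forall>g\<in>hom C G Z. g \<in> W \<longleftrightarrow> g \<in> W')" for Z W W'
  proof
    assume eq: "chi Z W = chi Z W'"
    show "\<forall>g\<in>hom C G Z. g \<in> W \<longleftrightarrow> g \<in> W'"
    proof
      fix g assume "g \<in> hom C G Z"
      moreover have "fst (snd (chi Z W)) (Inr g) = fst (snd (chi Z W')) (Inr g)" using eq by simp
      ultimately show "g \<in> W \<longleftrightarrow> g \<in> W'" using b by (auto simp: chi_def split: if_splits)
    qed
  qed (auto simp: chi_def intro!: restrict_ext)
  have chi_hom: "chi Z W \<in> hom set_cat (?h Z) B" for Z W
    by (auto simp: chi_def hom_def set_cat_def B_def)
  have is_chi: "\<exists>W \<subseteq> hom C G Z. u = chi Z W" if "u \<in> hom set_cat (?h Z) B" for u Z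
  proof -
    obtain A' f B' where u: "u = (A', f, B')" by (cases u)
    then have f: "u = (?h Z, f, B)" "f \<in> ?h Z \<rightarrow>\<^sub>E B"
      using that unfolding hom_def[of set_cat] by (auto simp: set_cat_def)
    have "f = (\<lambda>x\<in>?h Z. if projr x \<in> {g \<in> hom C G Z. f (Inr g) = Inl b1} then Inl b1 else Inl b0)"
      using f(2) by (intro extensionalityI[of _ "?h Z"]) (auto simp: B_def PiE_def Pi_def)
    then show ?thesis using f(1) by (intro exI[of _ "{g \<in> hom C G Z. f (Inr g) = Inl b1}"]) (auto simp: chi_def)
  qed
  have chi_comp: "Cmp set_cat (chi Z W) (arr ?H f) = chi Y W' \<longleftrightarrow>
      (\<forall>g\<in>hom C G Y. Cmp C f g \<in> W \<longleftrightarrow> g \<in> W')" if f: "f \<in> hom C Y Z" for Z Y W W' f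
  proof -
    have dc: "Dom C f = Y" "Cod C f = Z" using f by (auto simp: hom_def)
    have "Cmp set_cat (chi Z W) (arr ?H f) = chi Y {g. Cmp C f g \<in> W}"
      using cmp[OF _ f] dc
      by (auto simp: chi_def hom_functor_def set_cat_def compose_def image_iff intro!: restrict_ext)
    then show ?thesis by (simp add: chi_eq)
  qed
  have colim: "colimit_cocone (poset_cat P r) set_cat (fcomp ?H D) (?h X) (\<lambda>i. arr ?H (c i))"
    using G diagram colimit
    unfolding generated_def directed_mono_colims_to_colims_def by (simp add: hom_functor_def)
  have "cocone (poset_cat P r) set_cat (fcomp ?H D) B (\<lambda>i. chi (obj D i) (V i))"
    unfolding cocone_def
  proof (intro conjI ballI)
    show "B \<in> Ob set_cat" by (simp add: set_cat_def)
    show "chi (obj D i) (V i) \<in> hom set_cat (obj (fcomp ?H D) i) B" for i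
      using chi_hom by (simp add: fcomp_def hom_functor_def)
    fix u assume "u \<in> Ar (poset_cat P r)"
    then obtain i j where u: "u = (i, j)" "(i, j) \<in> r" by (cases u) (auto simp: poset_cat_def)
    show "Cmp set_cat (chi (obj D (Cod (poset_cat P r) u)) (V (Cod (poset_cat P r) u))) (arr (fcomp ?H D) u)
        = chi (obj D (Dom (poset_cat P r) u)) (V (Dom (poset_cat P r) u))"
      using chi_comp[OF D_arr[OF u(2)]] V[OF u(2)] by (simp add: u(1) fcomp_def poset_cat_def)
  qed
  then have ex1: "\<exists>!u. u \<in> hom set_cat (?h X) B \<and> (\<forall>i\<in>P. Cmp set_cat u (arr ?H (c i)) = chi (obj D i) (V i))"
    using colim unfolding colimit_cocone_def by (simp add: poset_cat_def)
  have iff: "(\<forall>i\<in>P. Cmp set_cat (chi X W) (arr ?H (c i)) = chi (obj D i) (V i)) \<longleftrightarrow>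
      (\<forall>i\<in>P. \<forall>g\<in>hom C G (obj D i). Cmp C (c i) g \<in> W \<longleftrightarrow> g \<in> V i)" for W
    using chi_comp[OF c_hom] by simp
  show ?thesis
  proof (rule ex_ex1I)
    show "\<exists>W. W \<subseteq> hom C G X \<and> (\<forall>i\<in>P. \<forall>g\<in>hom C G (obj D i). Cmp C (c i) g \<in> W \<longleftrightarrow> g \<in> V i)"
      using ex1 is_chi iff by metis
  next
    fix W W'
    assume W: "W \<subseteq> hom C G X \<and> (\<forall>i\<in>P. \<forall>g\<in>hom C G (obj D i). Cmp C (c i) g \<in> W \<longleftrightarrow> g \<in> V i)"
      and W': "W' \<subseteq> hom C G X \<and> (\<forall>i\<in>P. \<forall>g\<in>hom C G (obj D i). Cmp C (c i) g \<in> W' \<longleftrightarrow> g \<in> V i)"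
    have "chi X W = chi X W'"
      using ex1 chi_hom[of X] iff[of W] iff[of W'] W W' by metis
    then show "W = W'" using W W' by (auto simp: chi_eq)
  qed
qed

text \<open>
  The whole hom-set and the set of morphisms that factor through a stage both restrict to the full
  hom-set at each stage, so they are equal.
\<close>

lemma generated_factor:
  assumes G: "generated \<theta> lam C G" and f: "f \<in> hom C G X"
  obtains i g where "i \<in> P" and "g \<in> hom C G (obj D i)" and "Cmp C (c i) g = f"
proof -
  let ?W = "{Cmp C (c i) g | i g. i \<in> P \<and> g \<in> hom C G (obj D i)}"
  have "\<exists>!W. W \<subseteq> hom C G X \<and> (\<forall>i\<in>P. \<forall>g\<in>hom C G (obj D i). Cmp C (c i) g \<in> W \<longleftrightarrow> g \<in> UNIV)"
    by (rule generated_subsets[OF G]) simp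
  moreover have "?W \<subseteq> hom C G X" "hom C G X \<subseteq> hom C G X" using cmp c_hom by blast+
  moreover have "\<forall>i\<in>P. \<forall>g\<in>hom C G (obj D i). Cmp C (c i) g \<in> ?W \<longleftrightarrow> g \<in> UNIV" by blast
  moreover have "\<forall>i\<in>P. \<forall>g\<in>hom C G (obj D i). Cmp C (c i) g \<in> hom C G X \<longleftrightarrow> g \<in> UNIV"
    using cmp c_hom by blast
  ultimately have "?W = hom C G X" by blast
  then have "f \<in> ?W" using f by simp
  then show thesis using that by blast
qed

text \<open>
  The morphisms that become equal to \<open>f\<close> at a later stage form a compatible family of subsets, so
  membership depends only on the composite with the cocone.  At the stage of \<open>f\<close> the only member is
  \<open>f\<close>, because the diagram consists of monomorphisms.
\<close>

lemma generated_cancel: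
  assumes G: "generated \<theta> lam C G" and i: "i \<in> P"
    and f: "f \<in> hom C G (obj D i)" and g: "g \<in> hom C G (obj D i)" and eq: "Cmp C (c i) f = Cmp C (c i) g"
  shows "f = g"
proof -
  define V where "V j = {x. \<exists>k. (i, k) \<in> r \<and> (j, k) \<in> r \<and> Cmp C (arr D (j, k)) x = Cmp C (arr D (i, k)) f}" for j
  have V: "Cmp C (arr D (j, l)) x \<in> V l \<longleftrightarrow> x \<in> V j" if jl: "(j, l) \<in> r" and x: "x \<in> hom C G (obj D j)" for j l x
  proof
    assume "Cmp C (arr D (j, l)) x \<in> V l"
    then show "x \<in> V j" using D_apply[OF jl _ x] r_trans[OF jl] by (auto simp: V_def)
  next
    assume "x \<in> V j"
    then obtain k where k: "(i, k) \<in> r" "(j, k) \<in> r" "Cmp C (arr D (j, k)) x = Cmp C (arr D (i, k)) f"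
      by (auto simp: V_def)
    obtain m where m: "(k, m) \<in> r" "(l, m) \<in> r" using upper2[of k l] k jl r_in by metis
    have "Cmp C (arr D (l, m)) (Cmp C (arr D (j, l)) x) = Cmp C (arr D (k, m)) (Cmp C (arr D (j, k)) x)"
      using D_apply[OF jl m(2) x] D_apply[OF k(2) m(1) x] by simp
    also have "\<dots> = Cmp C (arr D (i, m)) f" using D_apply[OF k(1) m(1) f] k(3) by simp
    finally show "Cmp C (arr D (j, l)) x \<in> V l" using r_trans[OF k(1) m(1)] m(2) by (auto simp: V_def)
  qed
  have "\<exists>W. W \<subseteq> hom C G X \<and> (\<forall>i\<in>P. \<forall>g\<in>hom C G (obj D i). Cmp C (c i) g \<in> W \<longleftrightarrow> g \<in> V i)"
    by (rule ex1_implies_ex[OF generated_subsets[where V = V, OF G V]])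
  then have "f \<in> V i \<longleftrightarrow> g \<in> V i" using i f g eq by metis
  moreover have "f \<in> V i" using r_refl[OF i] by (auto simp: V_def)
  ultimately obtain k where k: "(i, k) \<in> r" "Cmp C (arr D (i, k)) g = Cmp C (arr D (i, k)) f"
    by (auto simp: V_def)
  then show ?thesis using mono_cancel[OF D_mono[OF k(1)] D_arr[OF k(1)] f g] by simp
qed

end

text \<open>
  In a mono-generated category the generated objects detect equality of morphisms, so the colimit
  cocone consists of monomorphisms.
\<close>

lemma (in mono_diagram) colimit_mono:
  assumes gen: "mono_generated \<theta> lam C" and i: "i \<in> P"
  shows "mono_in C (c i)"
  unfolding mono_in_def
proof (intro conjI ballI impI)
  show "c i \<in> Ar C" using c_hom[OF i] by (simp add: hom_def)
  fix Z g h
  assume Z: "Z \<in> Ob C" and "g \<in> hom C Z (Dom C (c i))" "h \<in> hom C Z (Dom C (c i))"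
    and eq: "Cmp C (c i) g = Cmp C (c i) h"
  then have g: "g \<in> hom C Z (obj D i)" and h: "h \<in> hom C Z (obj D i)"
    using c_hom[OF i] by (auto simp: hom_def)
  obtain P' r' D' c' where d: "directed_mono_diagram \<theta> lam C P' r' D'"
    and gd: "\<forall>k\<in>P'. generated \<theta> lam C (obj D' k)" and cl: "colimit_cocone (poset_cat P' r') C D' Z c'"
    using gen Z unfolding mono_generated_def by blast
  have d': "directed_poset lam P' r'" using d by (simp add: directed_mono_diagram_def)
  interpret Z: mono_diagram C lam P' r' \<theta> D' Z c'
    by unfold_locales (rule theta_inf card_inf d d' cl)+
  have gh: "Cmp C g (c' k) = Cmp C h (c' k)" if k: "k \<in> P'" for k
  proof (rule generated_cancel[OF _ i])
    show "generated \<theta> lam C (obj D' k)" using gd k by blast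
    show "Cmp C g (c' k) \<in> hom C (obj D' k) (obj D i)" "Cmp C h (c' k) \<in> hom C (obj D' k) (obj D i)"
      using cmp[OF Z.c_hom[OF k]] g h by blast+
    show "Cmp C (c i) (Cmp C g (c' k)) = Cmp C (c i) (Cmp C h (c' k))"
      using cmp_assoc[OF Z.c_hom[OF k] g c_hom[OF i]] cmp_assoc[OF Z.c_hom[OF k] h c_hom[OF i]] eq by simp
  qed
  have "cocone (poset_cat P' r') C D' (obj D i) (\<lambda>k. Cmp C g (c' k))"
    unfolding cocone_def
  proof (intro conjI ballI)
    show "obj D i \<in> Ob C" using hom_Ob[OF g] by blast
    show "Cmp C g (c' k) \<in> hom C (obj D' k) (obj D i)" if "k \<in> Ob (poset_cat P' r')" for k
      using cmp[OF Z.c_hom g] that by (simp add: poset_cat_def)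
    fix u assume "u \<in> Ar (poset_cat P' r')"
    then obtain k l where u: "u = (k, l)" "(k, l) \<in> r'" by (cases u) (auto simp: poset_cat_def)
    show "Cmp C (Cmp C g (c' (Cod (poset_cat P' r') u))) (arr D' u) = Cmp C g (c' (Dom (poset_cat P' r') u))"
      using cmp_assoc[OF Z.D_arr[OF u(2)] Z.c_hom g] Z.c_comp[OF u(2)] Z.r_in[OF u(2)]
      by (simp add: u(1) poset_cat_def)
  qed
  then have "\<exists>!f. f \<in> hom C Z (obj D i) \<and> (\<forall>k\<in>Ob (poset_cat P' r'). Cmp C f (c' k) = Cmp C g (c' k))"
    using cl unfolding colimit_cocone_def by blast
  then obtain f where "\<And>f'. f' \<in> hom C Z (obj D i) \<and> (\<forall>k\<in>P'. Cmp C f' (c' k) = Cmp C g (c' k)) \<Longrightarrow> f' = f"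
    unfolding poset_cat_simps by (elim ex1E) blast
  from this[of g] this[of h] show "g = h" using g h gh by simp
qed


section \<open>Images of homomorphisms\<close>

context universal_theory
begin

text \<open>
  The induced substructure on a family of sets closed under the operations.  Operations are
  restricted because those of a structure are undefined outside its own tuples.
\<close>

definition sub :: "('s, 'f, 'r, 'u) struct \<Rightarrow> ('s \<Rightarrow> 'u set) \<Rightarrow> ('s, 'f, 'r, 'u) struct" where
  "sub N B =
    \<lparr>carr = B,
     fint = (\<lambda>f. restrict (fint N f) (\<Pi>\<^sub>E p\<in>fargs \<Sigma> f. B (fsort \<Sigma> f p))),
     rint = (\<lambda>R. rint N R \<inter> (\<Pi>\<^sub>E p\<in>rargs \<Sigma> R. B (rsort \<Sigma> R p)))\<rparr>"

definition incl :: "('s \<Rightarrow> 'u set) \<Rightarrow> 's \<Rightarrow> 'u \<Rightarrow> 'u" where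
  "incl B = (\<lambda>s\<in>sorts \<Sigma>. \<lambda>x\<in>B s. x)"

abbreviation range_of where "range_of M h \<equiv> \<lambda>s. h s ` carr M s"
abbreviation image where "image M N h \<equiv> sub N (range_of M h)"

lemma sub_carr [simp]: "carr (sub N B) s = B s"
  by (simp add: sub_def)

lemma sub_fint: "t \<in> ftup \<Sigma> f (sub N B) \<Longrightarrow> fint (sub N B) f t = fint N f t"
  by (simp add: sub_def tuples_def)

lemma sub_rint: "t \<in> rint (sub N B) R \<longleftrightarrow> t \<in> rint N R \<and> t \<in> rtup \<Sigma> R (sub N B)"
  by (simp add: sub_def tuples_def)

lemma incl_apply [simp]: "s \<in> sorts \<Sigma> \<Longrightarrow> x \<in> B s \<Longrightarrow> incl B s x = x"
  by (simp add: incl_def)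

lemma incl_tuple:
  assumes "\<sigma> ` Q \<subseteq> sorts \<Sigma>" and "t \<in> tuples Q \<sigma> (sub N B)"
  shows "tmap Q \<sigma> (incl B) t = t"
  by (rule tmap_id[OF tuples_ext[OF assms(2)]]) (use tuplesD[OF assms(2)] assms(1) in auto)

lemma sub_tuples_mono:
  assumes "\<sigma> ` Q \<subseteq> sorts \<Sigma>" and "\<And>s. s \<in> sorts \<Sigma> \<Longrightarrow> B s \<subseteq> carr K s" and "t \<in> tuples Q \<sigma> (sub N B)"
  shows "t \<in> tuples Q \<sigma> K"
  by (rule tuplesI[OF _ tuples_ext[OF assms(3)]]) (use tuplesD[OF assms(3)] assms(1,2) in force)

lemma image_fint_closed:
  assumes M: "struc M" and h: "homo M N h" and f: "f \<in> funs \<Sigma>" and t: "t \<in> ftup \<Sigma> f (image M N h)"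
  shows "fint N f t \<in> h (fres \<Sigma> f) ` carr M (fres \<Sigma> f)"
proof -
  obtain a where a: "a \<in> ftup \<Sigma> f M" "t = fmap \<Sigma> f h a"
    using lift_tuple[OF tuples_ext[OF t], of h "fsort \<Sigma> f" M] tuplesD[OF t] by auto
  then show ?thesis using hom_fint[OF h f a(1)] struc_fint[OF M f a(1)] by (metis imageI)
qed

lemma image_struc:
  assumes M: "struc M" and h: "homo M N h"
  shows "struc (image M N h)"
  unfolding structure_of_def
proof (intro conjI ballI)
  show "small \<theta> (carr (image M N h) s)" if "s \<in> sorts \<Sigma>" for s
    using M that card_of_image ordLeq_ordLess_trans unfolding structure_of_def small_def sub_carr by blast
next
  fix f assume f: "f \<in> funs \<Sigma>"
  show "fint (image M N h) f \<in> fun_tuples \<Sigma> (image M N h) f \<rightarrow>\<^sub>E carr (image M N h) (fres \<Sigma> f)"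
  proof (rule PiE_I)
    fix t assume "t \<in> fun_tuples \<Sigma> (image M N h) f"
    then have "t \<in> ftup \<Sigma> f (image M N h)" by (simp add: fun_tuples_def tuples_def)
    then show "fint (image M N h) f t \<in> carr (image M N h) (fres \<Sigma> f)"
      using image_fint_closed[OF M h f] sub_fint by simp
  qed (simp add: fun_tuples_def sub_def)
next
  show "rint (image M N h) R \<subseteq> rel_tuples \<Sigma> (image M N h) R" for R
    by (auto simp: sub_def rel_tuples_def)
qed

lemma incl_PiE:
  "(\<And>s. s \<in> sorts \<Sigma> \<Longrightarrow> B s \<subseteq> carr K s) \<Longrightarrow> incl B \<in> (\<Pi>\<^sub>E s\<in>sorts \<Sigma>. carr (sub N B) s \<rightarrow>\<^sub>E carr K s)"
  by (rule PiE_I) (auto simp: incl_def)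

lemma incl_embedding:
  assumes M: "struc M" and h: "homo M N h"
  shows "embedding \<Sigma> (image M N h) N (incl (range_of M h))"
  unfolding embedding_def
proof (intro conjI ballI impI)
  show "homo (image M N h) N (incl (range_of M h))"
  proof (rule homI[OF incl_PiE])
    show "h s ` carr M s \<subseteq> carr N s" if "s \<in> sorts \<Sigma>" for s using hom_carr[OF h that] by blast
    show "incl (range_of M h) (fres \<Sigma> f) (fint (image M N h) f t) = fint N f (fmap \<Sigma> f (incl (range_of M h)) t)"
      if "f \<in> funs \<Sigma>" "t \<in> ftup \<Sigma> f (image M N h)" for f t
      using incl_tuple[OF fsorts[OF that(1)] that(2)] image_fint_closed[OF M h that] sub_fint[OF that(2)]
        fres_sort[OF that(1)] by simp
    show "rmap \<Sigma> R (incl (range_of M h)) t \<in> rint N R" if "R \<in> rels \<Sigma>" "t \<in> rint (image M N h) R" for R t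
      using that incl_tuple[OF rsorts[OF that(1)]] by (auto simp: sub_rint)
  qed
  show "inj_on (incl (range_of M h) s) (carr (image M N h) s)" if "s \<in> sorts \<Sigma>" for s
    using that by (auto simp: inj_on_def)
  show "t \<in> rint (image M N h) R"
    if "R \<in> rels \<Sigma>" "t \<in> rtup \<Sigma> R (image M N h)" "rmap \<Sigma> R (incl (range_of M h)) t \<in> rint N R" for R t
    using that incl_tuple[OF rsorts[OF that(1)] that(2)] by (simp add: sub_rint)
qed

lemma image_model:
  assumes "struc M" and "N \<in> Ob \<M>" and "homo M N h"
  shows "image M N h \<in> Ob \<M>"
  using model_embedding[OF image_struc assms(2) incl_embedding] assms by blast

text \<open>
  The unique preimages under an embedding form a homomorphism, since equations and relations can be
  tested after applying the embedding.
\<close>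

lemma embedding_factor:
  assumes V: "struc V" and K: "struc K" and e: "embedding \<Sigma> V N e" and g: "homo K N g"
    and range: "\<And>s. s \<in> sorts \<Sigma> \<Longrightarrow> g s ` carr K s \<subseteq> e s ` carr V s"
  obtains k where "homo K V k" and "\<And>s a. s \<in> sorts \<Sigma> \<Longrightarrow> a \<in> carr K s \<Longrightarrow> e s (k s a) = g s a"
proof -
  note eh = embedding_hom[OF e]
  define k where "k = (\<lambda>s\<in>sorts \<Sigma>. \<lambda>a\<in>carr K s. inv_into (carr V s) (e s) (g s a))"
  have k: "k s a \<in> carr V s" "e s (k s a) = g s a" if "s \<in> sorts \<Sigma>" "a \<in> carr K s" for s a
    using that range[OF that(1)] inv_into_into[of "g s a" "e s" "carr V s"] f_inv_into_f[of "g s a" "e s" "carr V s"]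
    by (auto simp: k_def)
  have kt: "tmap Q \<sigma> e (tmap Q \<sigma> k a) = tmap Q \<sigma> g a" "tmap Q \<sigma> k a \<in> tuples Q \<sigma> V"
    if "\<sigma> ` Q \<subseteq> sorts \<Sigma>" "a \<in> tuples Q \<sigma> K" for Q \<sigma> a
  proof -
    show "tmap Q \<sigma> e (tmap Q \<sigma> k a) = tmap Q \<sigma> g a"
      unfolding tmap_tmap by (rule tmap_cong) (use k tuplesD[OF that(2)] that(1) in auto)
    show "tmap Q \<sigma> k a \<in> tuples Q \<sigma> V"
      by (rule tuplesI) (use k tuplesD[OF that(2)] that(1) in auto)
  qed
  have "homo K V k"
  proof (rule homI)
    show "k \<in> (\<Pi>\<^sub>E s\<in>sorts \<Sigma>. carr K s \<rightarrow>\<^sub>E carr V s)"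
      using k(1) by (intro PiE_I) (auto simp: k_def)
    fix f a assume f: "f \<in> funs \<Sigma>" and a: "a \<in> ftup \<Sigma> f K"
    note ka = kt[OF fsorts[OF f] a]
    have "e (fres \<Sigma> f) (k (fres \<Sigma> f) (fint K f a)) = e (fres \<Sigma> f) (fint V f (fmap \<Sigma> f k a))"
      using k(2)[OF fres_sort[OF f] struc_fint[OF K f a]] hom_fint[OF g f a] hom_fint[OF eh f ka(2)] ka(1)
      by simp
    then show "k (fres \<Sigma> f) (fint K f a) = fint V f (fmap \<Sigma> f k a)"
      using embedding_inj[OF e fres_sort[OF f] k(1)[OF fres_sort[OF f] struc_fint[OF K f a]]
          struc_fint[OF V f ka(2)]] by blast
  next
    fix R a assume R: "R \<in> rels \<Sigma>" and a: "a \<in> rint K R"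
    note ka = kt[OF rsorts[OF R] struc_rint[OF K R a]]
    show "rmap \<Sigma> R k a \<in> rint V R"
      using embedding_rint[OF e R ka(2)] ka(1) hom_rint[OF g R a] by simp
  qed
  then show thesis using that k(2) by blast
qed

lemma Mod_cmp_eqI:
  assumes "struc K" and "homo K V k" and "homo V N e" and "homo K N g"
    and "\<And>s a. s \<in> sorts \<Sigma> \<Longrightarrow> a \<in> carr K s \<Longrightarrow> e s (k s a) = g s a"
  shows "Cmp \<M> (V, e, N) (K, k, V) = (K, g, N)"
  using hom_eqI[OF homo_comp[OF assms(1-3)] assms(4)] assms(5) by (simp add: Mod_sel(6))

lemma injective_mono:
  assumes "M \<in> Ob \<M>" and "N \<in> Ob \<M>" and h: "homo M N h" and inj: "\<And>s. s \<in> sorts \<Sigma> \<Longrightarrow> inj_on (h s) (carr M s)"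
  shows "mono_in \<M> (M, h, N)"
  unfolding mono_in_def
proof (intro conjI ballI impI)
  show "(M, h, N) \<in> Ar \<M>" using assms by (simp add: Mod_sel(2))
  fix Z f g
  assume "f \<in> hom \<M> Z (Dom \<M> (M, h, N))" "g \<in> hom \<M> Z (Dom \<M> (M, h, N))"
    and eq: "Cmp \<M> (M, h, N) f = Cmp \<M> (M, h, N) g"
  then obtain f' g' where f: "f = (Z, f', M)" "homo Z M f'" and g: "g = (Z, g', M)" "homo Z M g'"
    by (auto simp: Mod_hom Mod_sel(3))
  have "hcomp \<Sigma> Z h f' = hcomp \<Sigma> Z h g'" using eq f(1) g(1) by (simp add: Mod_sel(6))
  then have "h s (f' s a) = h s (g' s a)" if "s \<in> sorts \<Sigma>" "a \<in> carr Z s" for s a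
    using hcomp_apply[OF that] by metis
  then have "f' = g'"
    using inj_onD[OF inj] hom_carr[OF f(2)] hom_carr[OF g(2)] by (intro hom_eqI[OF f(2) g(2)]) blast
  then show "f = g" using f g by simp
qed

text \<open>
  A structure that is the image of both homomorphisms from \<open>M\<close>, by the same surjection \<open>e\<close> from \<open>M\<close>.
  The definition is symmetric in the two targets, so that the forth condition can be reduced to the
  back condition.
\<close>

definition common_image where
  "common_image M N1 h1 N2 h2 W e1 e2 \<longleftrightarrow> W \<in> Ob \<M> \<and> embedding \<Sigma> W N1 e1 \<and> embedding \<Sigma> W N2 e2 \<and>
    (\<exists>e. \<forall>s\<in>sorts \<Sigma>. e s ` carr M s = carr W s \<and>
      (\<forall>a\<in>carr M s. e1 s (e s a) = h1 s a \<and> e2 s (e s a) = h2 s a))"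

lemma common_image_sym: "common_image M N1 h1 N2 h2 W e1 e2 \<Longrightarrow> common_image M N2 h2 N1 h1 W e2 e1"
  unfolding common_image_def by blast

text \<open>
  The image of the first homomorphism embeds into the second target by sending \<open>h1 s a\<close> to \<open>h2 s a\<close>.
  Equality of the kernels makes this well defined and injective.
\<close>

lemma ex_common_image:
  assumes M: "struc M" and N1: "N1 \<in> Ob \<M>" and h1: "homo M N1 h1" and h2: "homo M N2 h2"
    and ker: "\<And>s a b. s \<in> sorts \<Sigma> \<Longrightarrow> a \<in> carr M s \<Longrightarrow> b \<in> carr M s \<Longrightarrow> h1 s a = h1 s b \<longleftrightarrow> h2 s a = h2 s b"
    and rel: "\<And>R a. R \<in> rels \<Sigma> \<Longrightarrow> a \<in> rtup \<Sigma> R M \<Longrightarrow> rmap \<Sigma> R h1 a \<in> rint N1 R \<longleftrightarrow> rmap \<Sigma> R h2 a \<in> rint N2 R"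
  shows "\<exists>W e1 e2. common_image M N1 h1 N2 h2 W e1 e2"
proof -
  let ?B = "range_of M h1"
  let ?W = "image M N1 h1"
  define e2 where "e2 = (\<lambda>s\<in>sorts \<Sigma>. \<lambda>b\<in>?B s. h2 s (inv_into (carr M s) (h1 s) b))"
  have e2: "e2 s (h1 s a) = h2 s a" if "s \<in> sorts \<Sigma>" "a \<in> carr M s" for s a
    using that ker[OF that(1) inv_into_into[of "h1 s a" "h1 s" "carr M s"] that(2)]
      f_inv_into_f[of "h1 s a" "h1 s" "carr M s"] by (simp add: e2_def)
  have e2t: "tmap Q \<sigma> e2 (tmap Q \<sigma> h1 a) = tmap Q \<sigma> h2 a" if "\<sigma> ` Q \<subseteq> sorts \<Sigma>" "a \<in> tuples Q \<sigma> M" for Q \<sigma> a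
    unfolding tmap_tmap by (rule tmap_cong) (use e2 tuplesD[OF that(2)] that(1) in auto)
  have lift: "\<exists>a \<in> tuples Q \<sigma> M. t = tmap Q \<sigma> h1 a" if "t \<in> tuples Q \<sigma> ?W" for Q \<sigma> t
    using lift_tuple[OF tuples_ext[OF that], of h1 \<sigma> M] tuplesD[OF that] by (metis sub_carr)
  have "embedding \<Sigma> ?W N2 e2"
    unfolding embedding_def
  proof (intro conjI ballI impI)
    show "homo ?W N2 e2"
    proof (rule homI)
      show "e2 \<in> (\<Pi>\<^sub>E s\<in>sorts \<Sigma>. carr ?W s \<rightarrow>\<^sub>E carr N2 s)"
      proof (rule PiE_I)
        fix s assume s: "s \<in> sorts \<Sigma>"
        show "e2 s \<in> carr ?W s \<rightarrow>\<^sub>E carr N2 s"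
        proof (rule PiE_I)
          show "e2 s x \<in> carr N2 s" if "x \<in> carr ?W s" for x
            using that e2[OF s] hom_carr[OF h2 s] by auto
        qed (simp add: e2_def s)
      qed (simp add: e2_def)
    next
      fix f t assume f: "f \<in> funs \<Sigma>" and t: "t \<in> ftup \<Sigma> f ?W"
      obtain a where a: "a \<in> ftup \<Sigma> f M" "t = fmap \<Sigma> f h1 a" using lift[OF t] by blast
      have "fint ?W f t = h1 (fres \<Sigma> f) (fint M f a)"
        using sub_fint[OF t] hom_fint[OF h1 f a(1)] a(2) by simp
      then show "e2 (fres \<Sigma> f) (fint ?W f t) = fint N2 f (fmap \<Sigma> f e2 t)"
        using e2[OF fres_sort[OF f] struc_fint[OF M f a(1)]] hom_fint[OF h2 f a(1)]
          e2t[OF fsorts[OF f] a(1)] a(2) by simp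
    next
      fix R t assume R: "R \<in> rels \<Sigma>" and "t \<in> rint ?W R"
      then have t: "t \<in> rint N1 R" "t \<in> rtup \<Sigma> R ?W" by (simp_all add: sub_rint)
      obtain a where a: "a \<in> rtup \<Sigma> R M" "t = rmap \<Sigma> R h1 a" using lift[OF t(2)] by blast
      then show "rmap \<Sigma> R e2 t \<in> rint N2 R" using rel[OF R a(1)] e2t[OF rsorts[OF R] a(1)] t(1) by simp
    qed
  next
    fix s assume "s \<in> sorts \<Sigma>"
    then show "inj_on (e2 s) (carr ?W s)" using e2 ker by (auto simp: inj_on_def)
  next
    fix R t assume R: "R \<in> rels \<Sigma>" and t: "t \<in> rtup \<Sigma> R ?W" and "rmap \<Sigma> R e2 t \<in> rint N2 R"
    moreover obtain a where a: "a \<in> rtup \<Sigma> R M" "t = rmap \<Sigma> R h1 a" using lift[OF t] by blast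
    ultimately show "t \<in> rint ?W R"
      using rel[OF R a(1)] e2t[OF rsorts[OF R] a(1)] by (simp add: sub_rint)
  qed
  moreover have "\<forall>s\<in>sorts \<Sigma>. h1 s ` carr M s = carr ?W s \<and>
      (\<forall>a\<in>carr M s. incl ?B s (h1 s a) = h1 s a \<and> e2 s (h1 s a) = h2 s a)"
    using e2 by simp
  ultimately have "common_image M N1 h1 N2 h2 ?W (incl ?B) e2"
    using image_model[OF M N1 h1] incl_embedding[OF M h1] unfolding common_image_def by blast
  then show ?thesis by blast
qed

end

text \<open>
  Generated objects of the category of models only see colimits of monomorphisms, and the maps into
  a concrete colimit need not be monomorphisms.  But the colimit is also the directed union of the
  images of the stages, along inclusions.
\<close>

lemma (in concrete_colimit) generated_range:
  assumes K: "generated \<theta> lam \<M> K" and g: "homo K N g"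
  shows "\<exists>i\<in>P. \<forall>s\<in>sorts \<Sigma>. g s ` carr K s \<subseteq> q i s ` carr (M i) s"
proof -
  define B where "B i = range_of (M i) (q i)" for i
  let ?I = "\<lambda>i. sub N (B i)"
  define D where "D = \<lparr>obj = ?I, arr = (\<lambda>(i, j). (?I i, incl (B i), ?I j))\<rparr>"
  have I: "?I i \<in> Ob \<M>" "embedding \<Sigma> (?I i) N (incl (B i))" if "i \<in> P" for i
    using image_model[OF M_struc N_model q_hom] incl_embedding[OF M_struc q_hom] that
    unfolding B_def by blast+
  have B_mono: "B i s \<subseteq> B j s" if ij: "(i, j) \<in> r" and s: "s \<in> sorts \<Sigma>" for i j s
    using q_comp[OF ij s] map_carr[OF ij s] unfolding B_def by (metis image_subsetI imageI)
  have incl_hom: "homo (?I i) (?I j) (incl (B i))" if ij: "(i, j) \<in> r" for i j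
  proof (rule homI[OF incl_PiE])
    show "B i s \<subseteq> carr (?I j) s" if "s \<in> sorts \<Sigma>" for s using B_mono[OF ij that] by simp
    fix f t assume f: "f \<in> funs \<Sigma>" and t: "t \<in> ftup \<Sigma> f (?I i)"
    have "t \<in> ftup \<Sigma> f (?I j)" by (rule sub_tuples_mono[OF fsorts[OF f] _ t]) (use B_mono[OF ij] in simp)
    then show "incl (B i) (fres \<Sigma> f) (fint (?I i) f t) = fint (?I j) f (fmap \<Sigma> f (incl (B i)) t)"
      using sub_fint incl_tuple[OF fsorts[OF f] t] sub_fint[OF t] fres_sort[OF f]
        struc_fint[OF model_struc[OF I(1)] f t] r_in[OF ij] by simp
  next
    fix R t assume R: "R \<in> rels \<Sigma>" and t: "t \<in> rint (?I i) R"
    then have ti: "t \<in> rtup \<Sigma> R (?I i)" by (simp add: sub_rint)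
    have "t \<in> rtup \<Sigma> R (?I j)" by (rule sub_tuples_mono[OF rsorts[OF R] _ ti]) (use B_mono[OF ij] in simp)
    then show "rmap \<Sigma> R (incl (B i)) t \<in> rint (?I j) R"
      using incl_tuple[OF rsorts[OF R] ti] t by (simp add: sub_rint)
  qed
  interpret U: concrete_colimit \<theta> lam \<kappa> \<Sigma> T P r ?I "\<lambda>i j. incl (B i)" "\<lambda>i. incl (B i)" N
  proof unfold_locales
    show "small \<theta> P" by (rule small_P)
    show "i \<in> P \<Longrightarrow> ?I i \<in> Ob \<M>" for i by (rule I)
    show "(i, j) \<in> r \<Longrightarrow> homo (?I i) (?I j) (incl (B i))" for i j by (rule incl_hom)
    show "incl (B i) s a = a" if "s \<in> sorts \<Sigma>" "a \<in> carr (?I i) s" for i s a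
      using that by simp
    show "incl (B j) s (incl (B i) s a) = incl (B i) s a"
      if "(i, j) \<in> r" "(j, k) \<in> r" "s \<in> sorts \<Sigma>" "a \<in> carr (?I i) s" for i j k s a
      using that B_mono[OF that(1,3)] by auto
    show "incl (B j) s (incl (B i) s a) = incl (B i) s a"
      if "(i, j) \<in> r" "s \<in> sorts \<Sigma>" "a \<in> carr (?I i) s" for i j s a
      using that B_mono[OF that(1,2)] by auto
    show "\<exists>k. (i, k) \<in> r \<and> incl (B i) s a = incl (B i) s b"
      if "i \<in> P" "incl (B i) s a = incl (B i) s b" for i s a b
      using that r_refl by blast
    show "struc N" by (rule N_struc)
    show "homo (?I i) N (incl (B i))" if "i \<in> P" for i using embedding_hom[OF I(2)[OF that]] .
    show "\<exists>i\<in>P. x \<in> incl (B i) s ` carr (?I i) s" if s: "s \<in> sorts \<Sigma>" and x: "x \<in> carr N s" for s x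
    proof -
      obtain i where "i \<in> P" "x \<in> B i s" using surj[OF s x] unfolding B_def by blast
      then show ?thesis using incl_apply[OF s] by (metis sub_carr imageI)
    qed
    show "\<exists>k. (i, k) \<in> r \<and> rmap \<Sigma> R (incl (B i)) a \<in> rint (?I k) R"
      if i: "i \<in> P" and R: "R \<in> rels \<Sigma>" and a: "a \<in> rtup \<Sigma> R (?I i)"
        and x: "rmap \<Sigma> R (incl (B i)) a \<in> rint N R" for i R a
      using embedding_rint[OF I(2)[OF i] R a x] incl_tuple[OF rsorts[OF R] a] r_refl[OF i] by metis
  qed
  have pres: "U.presents D" by (simp add: U.presents_def D_def)
  have colim: "colimit_cocone (poset_cat P r) \<M> D N (\<lambda>i. (?I i, incl (B i), N))"
    by (rule U.colimit_in_Mod[OF pres]) simp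
  have "is_functor (poset_cat P r) \<M> D"
    unfolding is_functor_def
  proof (intro conjI ballI)
    show "obj D a \<in> Ob \<M>" if "a \<in> Ob (poset_cat P r)" for a using that I by (simp add: D_def)
    show "arr D u \<in> hom \<M> (obj D (Dom (poset_cat P r) u)) (obj D (Cod (poset_cat P r) u))"
      if "u \<in> Ar (poset_cat P r)" for u
      using that incl_hom I r_in by (cases u) (auto simp: D_def Mod_hom)
    show "arr D (Idn (poset_cat P r) a) = Idn \<M> (obj D a)" for a
      by (simp add: D_def Mod_sel(5) hid_def incl_def id_def)
    fix a b c u v
    assume "u \<in> hom (poset_cat P r) a b" "v \<in> hom (poset_cat P r) b c"
    then have uv: "u = (a, b)" "v = (b, c)" "(a, b) \<in> r" "(b, c) \<in> r"
      by (cases u; cases v; auto simp: hom_def)+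
    have "Cmp \<M> (?I b, incl (B b), ?I c) (?I a, incl (B a), ?I b) = (?I a, incl (B a), ?I c)"
    proof (rule Mod_cmp_eqI[OF model_struc[OF I(1)] incl_hom[OF uv(3)] incl_hom[OF uv(4)]
          incl_hom[OF r_trans[OF uv(3,4)]]])
      show "a \<in> P" using r_in[OF uv(3)] by blast
      show "incl (B b) s (incl (B a) s x) = incl (B a) s x" if "s \<in> sorts \<Sigma>" "x \<in> carr (?I a) s" for s x
        using U.map_comp[OF uv(3,4) that] .
    qed
    then show "arr D (Cmp (poset_cat P r) v u) = Cmp \<M> (arr D v) (arr D u)"
      by (simp add: D_def uv)
  qed
  moreover have "mono_in \<M> (arr D u)" if "u \<in> r" for u
  proof -
    obtain i j where u: "u = (i, j)" by (cases u)
    show ?thesis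
      using injective_mono[OF I(1) I(1) incl_hom] that r_in unfolding u D_def by (auto simp: inj_on_def)
  qed
  ultimately have dia: "directed_mono_diagram \<theta> lam \<M> P r D"
    using small_P directed unfolding directed_mono_diagram_def by blast
  interpret category \<M> by (rule category_Mod)
  interpret mono_diagram \<M> lam P r \<theta> D N "\<lambda>i. (?I i, incl (B i), N)"
    by unfold_locales (rule theta_inf dia colim)+
  have "K \<in> Ob \<M>" using K by (simp add: generated_def)
  then have "(K, g, N) \<in> hom \<M> K N" using g N_model by (simp add: Mod_hom)
  then obtain i u where i: "i \<in> P" and u: "u \<in> hom \<M> K (obj D i)"
    and eq: "Cmp \<M> (?I i, incl (B i), N) u = (K, g, N)"
    using generated_factor[OF K] by blast
  obtain k where k: "u = (K, k, ?I i)" "homo K (?I i) k" using u by (auto simp: Mod_hom D_def)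
  have gk: "hcomp \<Sigma> K (incl (B i)) k = g" using eq by (simp add: k(1) Mod_sel(6))
  have "g s a \<in> B i s" if "s \<in> sorts \<Sigma>" "a \<in> carr K s" for s a
    using hcomp_apply[OF that, of "incl (B i)" k] hom_carr[OF k(2) that] that(1) unfolding gk by simp
  then show ?thesis using i unfolding B_def by blast
qed


section \<open>Transfer of dense sets of spans\<close>

definition has_back where
  "has_back \<theta> lam C X S \<longleftrightarrow>
    (\<forall>(U, x, y)\<in>S. \<forall>G g. generated \<theta> lam C G \<and> g \<in> hom C G X \<and> mono_in C g \<longrightarrow>
      (\<exists>(V, x', y')\<in>S. \<exists>s\<in>hom C G V. \<exists>w\<in>hom C U V.
        Cmp C x' s = g \<and> Cmp C x' w = x \<and> Cmp C y' w = y))"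

definition swap :: "'o \<times> 'm \<times> 'm \<Rightarrow> 'o \<times> 'm \<times> 'm" where
  "swap = (\<lambda>(U, x, y). (U, y, x))"

lemma swap_simp [simp]: "swap (U, x, y) = (U, y, x)"
  by (simp add: swap_def)

lemma swap_swap [simp]: "swap (swap p) = p"
  by (cases p) simp

text \<open>The forth condition is the back condition for the reversed spans.\<close>

lemma back_swap:
  "has_back \<theta> lam C Y (swap ` S) \<longleftrightarrow>
    (\<forall>(U, x, y)\<in>S. \<forall>G g. generated \<theta> lam C G \<and> g \<in> hom C G Y \<and> mono_in C g \<longrightarrow>
      (\<exists>(V, x', y')\<in>S. \<exists>s\<in>hom C G V. \<exists>w\<in>hom C U V.
        Cmp C y' s = g \<and> Cmp C x' w = x \<and> Cmp C y' w = y))"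
  unfolding has_back_def by (simp add: swap_def split_def conj_commute conj_left_commute)

lemma dense_spans_iff:
  "dense_spans \<theta> lam C X Y S \<longleftrightarrow> small \<theta> S \<and> (\<forall>p\<in>S. is_span C X Y p) \<and> S \<noteq> {} \<and>
    has_back \<theta> lam C X S \<and> has_back \<theta> lam C Y (swap ` S)"
  unfolding dense_spans_def back_swap unfolding has_back_def by blast

lemma spans_swap: "\<forall>p\<in>S. is_span C X Y p \<Longrightarrow> \<forall>p\<in>swap ` S. is_span C Y X p"
  by (auto simp: is_span_def)

text \<open>
  Let \<open>x p\<close> factor through a generated subobject of \<open>X\<close>.  After extending the span so that this
  subobject lifts to its apex, the factorization is one of \<open>p\<close> itself, because the left leg is
  a monomorphism, and can be followed by the right leg.
\<close>

lemma (in category) back_factor: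
  assumes hb: "has_back \<theta> lam C X S" and spans: "\<forall>p\<in>S. is_span C X Y p" and U: "(U, x, y) \<in> S"
    and H: "generated \<theta> lam C H" and c: "c \<in> hom C H X" "mono_in C c"
    and p: "p \<in> hom C G U" and m: "m \<in> hom C G H" and eq: "Cmp C x p = Cmp C c m"
  shows "\<exists>n\<in>hom C H Y. Cmp C y p = Cmp C n m"
proof -
  obtain V x' y' s w where V: "(V, x', y') \<in> S" and s: "s \<in> hom C H V" and w: "w \<in> hom C U V"
    and e: "Cmp C x' s = c" "Cmp C x' w = x" "Cmp C y' w = y"
    using hb U H c unfolding has_back_def by blast
  have x': "x' \<in> hom C V X" "mono_in C x'" and y': "y' \<in> hom C V Y"
    using bspec[OF spans V] by (simp_all add: is_span_def)
  have "Cmp C x' (Cmp C w p) = Cmp C x' (Cmp C s m)"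
    using cmp_assoc[OF p w x'(1)] cmp_assoc[OF m s x'(1)] e eq by simp
  then have "Cmp C w p = Cmp C s m"
    using mono_cancel[OF x'(2,1) cmp[OF p w] cmp[OF m s]] by blast
  then have "Cmp C y p = Cmp C (Cmp C y' s) m"
    using cmp_assoc[OF p w y'] cmp_assoc[OF m s y'] e(3) by simp
  then show ?thesis using cmp[OF s y'] by blast
qed

locale model_functor = universal_theory \<theta> lam \<kappa> \<Sigma> T + category A
  for \<theta> :: "'u rel" and lam :: "'l rel" and \<kappa> :: "'k rel"
    and \<Sigma> :: "('s, 'f, 'r, 'u) lang" and T :: "('s, 'f, 'r, 'u) sentence set"
    and A :: "('o, 'm) cat" +
  fixes F :: "('o, 'm, ('s, 'f, 'r, 'u) struct,
               ('s, 'f, 'r, 'u) struct \<times> ('s \<Rightarrow> 'u \<Rightarrow> 'u) \<times> ('s, 'f, 'r, 'u) struct) fctr"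
  assumes mono_gen: "mono_generated \<theta> lam A"
    and F_functor: "is_functor A (Mod \<theta> \<Sigma> T) F"
    and F_colims: "directed_mono_colims_to_colims \<theta> lam A (Mod \<theta> \<Sigma> T) F"
begin

definition fm :: "'m \<Rightarrow> 's \<Rightarrow> 'u \<Rightarrow> 'u" where
  "fm f = fst (snd (arr F f))"

lemma F_model: "a \<in> Ob A \<Longrightarrow> obj F a \<in> Ob \<M>"
  using F_functor by (simp add: is_functor_def)

lemma F_struc: "a \<in> Ob A \<Longrightarrow> struc (obj F a)"
  using F_model model_struc by blast

lemma F_arr:
  assumes "f \<in> hom A a b"
  shows "arr F f = (obj F a, fm f, obj F b)" "homo (obj F a) (obj F b) (fm f)"
proof -
  have "arr F f \<in> hom \<M> (obj F a) (obj F b)"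
    using F_functor assms by (auto simp: is_functor_def hom_def[of A])
  then show "arr F f = (obj F a, fm f, obj F b)" "homo (obj F a) (obj F b) (fm f)"
    by (auto simp: Mod_hom fm_def)
qed

lemma fm_comp:
  assumes f: "f \<in> hom A a b" and g: "g \<in> hom A b c" and s: "s \<in> sorts \<Sigma>" and x: "x \<in> carr (obj F a) s"
  shows "fm (Cmp A g f) s x = fm g s (fm f s x)"
proof -
  have "arr F (Cmp A g f) = Cmp \<M> (arr F g) (arr F f)"
    using F_functor f g hom_Ob[OF f] hom_Ob[OF g] unfolding is_functor_def by blast
  then have "fm (Cmp A g f) = hcomp \<Sigma> (obj F a) (fm g) (fm f)"
    using F_arr(1)[OF f] F_arr(1)[OF g] F_arr(1)[OF cmp[OF f g]] by (simp add: Mod_sel(6))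
  then show ?thesis using s x by simp
qed

lemma fm_id:
  assumes "a \<in> Ob A" "s \<in> sorts \<Sigma>" "x \<in> carr (obj F a) s"
  shows "fm (Idn A a) s x = x"
proof -
  have "arr F (Idn A a) = Idn \<M> (obj F a)" using F_functor assms(1) by (simp add: is_functor_def)
  then show ?thesis using assms by (simp add: fm_def Mod_sel(5))
qed

lemma fm_tmap_comp:
  assumes f: "f \<in> hom A a b" and g: "g \<in> hom A b c" and "\<sigma> ` Q \<subseteq> sorts \<Sigma>" and t: "t \<in> tuples Q \<sigma> (obj F a)"
  shows "tmap Q \<sigma> (fm g) (tmap Q \<sigma> (fm f) t) = tmap Q \<sigma> (fm (Cmp A g f)) t"
  unfolding tmap_tmap by (rule tmap_cong) (use fm_comp[OF f g] tuplesD[OF t] assms(3) in auto)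

text \<open>
  Every object is a directed union of generated subobjects, in the sense that the cocone is monic.
  Under \<open>F\<close> only the colimit survives, but it is concrete, being a colimit of models.
\<close>

lemma presentation:
  assumes "X \<in> Ob A"
  obtains P r D c where "mono_diagram A lam P r \<theta> D X c"
    and "\<forall>i\<in>P. generated \<theta> lam A (obj D i)" and "\<forall>i\<in>P. mono_in A (c i)"
    and "concrete_colimit \<theta> lam \<kappa> \<Sigma> T P r (\<lambda>i. obj F (obj D i)) (\<lambda>i j. fm (arr D (i, j)))
      (\<lambda>i. fm (c i)) (obj F X)"
proof -
  obtain P r D c where d: "directed_mono_diagram \<theta> lam A P r D"
    and gen: "\<forall>i\<in>P. generated \<theta> lam A (obj D i)" and colim: "colimit_cocone (poset_cat P r) A D X c"
    using mono_gen assms unfolding mono_generated_def by blast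
  have dir: "directed_poset lam P r" "small \<theta> P" using d by (simp_all add: directed_mono_diagram_def)
  interpret mono_diagram A lam P r \<theta> D X c
    by unfold_locales (rule theta_inf lam_inf d dir colim)+
  have DO: "obj D i \<in> Ob A" if "i \<in> P" for i using c_hom[OF that] hom_Ob by blast
  interpret M: directed_models \<theta> lam \<kappa> \<Sigma> T P r "\<lambda>i. obj F (obj D i)" "\<lambda>i j. fm (arr D (i, j))"
  proof unfold_locales
    show "small \<theta> P" by (rule dir)
    show "obj F (obj D i) \<in> Ob \<M>" if "i \<in> P" for i using F_model[OF DO[OF that]] .
    show "homo (obj F (obj D i)) (obj F (obj D j)) (fm (arr D (i, j)))" if "(i, j) \<in> r" for i j
      using F_arr(2)[OF D_arr[OF that]] .
    show "fm (arr D (i, i)) s a = a" if "i \<in> P" "s \<in> sorts \<Sigma>" "a \<in> carr (obj F (obj D i)) s" for i s a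
      using fm_id[OF DO] D_id that by simp
    show "fm (arr D (j, k)) s (fm (arr D (i, j)) s a) = fm (arr D (i, k)) s a"
      if "(i, j) \<in> r" "(j, k) \<in> r" "s \<in> sorts \<Sigma>" "a \<in> carr (obj F (obj D i)) s" for i j k s a
      using fm_comp[OF D_arr[OF that(1)] D_arr[OF that(2)] that(3,4)] D_comp[OF that(1,2)] by simp
  qed
  have "M.presents (fcomp F D)"
    using F_arr(1)[OF D_arr] by (auto simp: M.presents_def fcomp_def)
  moreover have "colimit_cocone (poset_cat P r) \<M> (fcomp F D) (obj F X) (\<lambda>i. arr F (c i))"
    using F_colims d colim unfolding directed_mono_colims_to_colims_def by blast
  ultimately have "concrete_colimit \<theta> lam \<kappa> \<Sigma> T P r (\<lambda>i. obj F (obj D i)) (\<lambda>i j. fm (arr D (i, j)))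
      (\<lambda>i. fm (c i)) (obj F X)"
    using M.colimit_concrete unfolding fm_def by blast
  then show thesis
    using that mono_diagram_axioms gen colimit_mono[OF mono_gen] by blast
qed

text \<open>
  The stage \<open>k\<close> is arbitrary because a coincidence in \<open>F X\<close> between data from \<open>F G\<close> is known to hold
  only at some stage after \<open>j\<close>; the map \<open>n\<close> then carries it to \<open>F Y\<close>.
\<close>

lemma stage_transfer:
  assumes hb: "has_back \<theta> lam A X S" and spans: "\<forall>p\<in>S. is_span A X Y p" and U: "(U, x, y) \<in> S"
    and mono: "mono_diagram A lam P r \<theta> D X c" and gen: "\<forall>i\<in>P. generated \<theta> lam A (obj D i)"
    and c_mono: "\<forall>i\<in>P. mono_in A (c i)"
    and G: "generated \<theta> lam A G" and u: "u \<in> hom A G U"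
  obtains j m where "j \<in> P" and "m \<in> hom A G (obj D j)" and "Cmp A x u = Cmp A (c j) m"
    and "\<And>k. (j, k) \<in> r \<Longrightarrow>
      \<exists>n\<in>hom A (obj D k) Y. Cmp A y u = Cmp A n (Cmp A (arr D (j, k)) m)"
proof -
  interpret mono_diagram A lam P r \<theta> D X c by (rule mono)
  have x: "x \<in> hom A U X" using bspec[OF spans U] by (simp add: is_span_def)
  obtain j m where j: "j \<in> P" and m: "m \<in> hom A G (obj D j)" and eq: "Cmp A (c j) m = Cmp A x u"
    using generated_factor[OF G cmp[OF u x]] .
  have "\<exists>n\<in>hom A (obj D k) Y. Cmp A y u = Cmp A n (Cmp A (arr D (j, k)) m)" if jk: "(j, k) \<in> r" for k
  proof (rule back_factor[OF hb spans U])
    have k: "k \<in> P" using r_in[OF jk] by blast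
    show "generated \<theta> lam A (obj D k)" "c k \<in> hom A (obj D k) X" "mono_in A (c k)"
      using gen c_hom c_mono k by blast+
    show "Cmp A (arr D (j, k)) m \<in> hom A G (obj D k)" using cmp[OF m D_arr[OF jk]] .
    show "Cmp A x u = Cmp A (c k) (Cmp A (arr D (j, k)) m)"
      using cmp_assoc[OF m D_arr[OF jk] c_hom[OF k]] c_comp[OF jk] eq by simp
  qed (rule u)
  then show thesis using that j m eq by simp
qed

text \<open>
  Two elements, or the fewer than \<open>lam\<close> entries of a tuple, come from one generated stage of \<open>U\<close>, to
  which the factorizations above apply.
\<close>

lemma
  assumes hb: "has_back \<theta> lam A X S" and spans: "\<forall>p\<in>S. is_span A X Y p" and U: "(U, x, y) \<in> S"
  shows kernel_transfer: "s \<in> sorts \<Sigma> \<Longrightarrow> a \<in> carr (obj F U) s \<Longrightarrow> b \<in> carr (obj F U) s \<Longrightarrow>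
      fm x s a = fm x s b \<Longrightarrow> fm y s a = fm y s b"
    and relation_transfer: "R \<in> rels \<Sigma> \<Longrightarrow> a' \<in> rtup \<Sigma> R (obj F U) \<Longrightarrow>
      rmap \<Sigma> R (fm x) a' \<in> rint (obj F X) R \<Longrightarrow> rmap \<Sigma> R (fm y) a' \<in> rint (obj F Y) R"
proof -
  have x: "x \<in> hom A U X" and y: "y \<in> hom A U Y" using bspec[OF spans U] by (simp_all add: is_span_def)
  obtain PU rU DU cU where MU: "mono_diagram A lam PU rU \<theta> DU U cU"
    and GU: "\<forall>i\<in>PU. generated \<theta> lam A (obj DU i)"
    and CU: "concrete_colimit \<theta> lam \<kappa> \<Sigma> T PU rU (\<lambda>i. obj F (obj DU i)) (\<lambda>i j. fm (arr DU (i, j)))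
      (\<lambda>i. fm (cU i)) (obj F U)"
    using presentation[of U] hom_Ob[OF x] by metis
  obtain P r D c where MX: "mono_diagram A lam P r \<theta> D X c"
    and GX: "\<forall>i\<in>P. generated \<theta> lam A (obj D i)" and cX: "\<forall>i\<in>P. mono_in A (c i)"
    and CX: "concrete_colimit \<theta> lam \<kappa> \<Sigma> T P r (\<lambda>i. obj F (obj D i)) (\<lambda>i j. fm (arr D (i, j)))
      (\<lambda>i. fm (c i)) (obj F X)"
    using presentation[of X] hom_Ob[OF x] by metis
  interpret U: mono_diagram A lam PU rU \<theta> DU U cU by (rule MU)
  interpret X: mono_diagram A lam P r \<theta> D X c by (rule MX)
  interpret FU: concrete_colimit \<theta> lam \<kappa> \<Sigma> T PU rU "\<lambda>i. obj F (obj DU i)" "\<lambda>i j. fm (arr DU (i, j))"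
      "\<lambda>i. fm (cU i)" "obj F U" by (rule CU)
  interpret FX: concrete_colimit \<theta> lam \<kappa> \<Sigma> T P r "\<lambda>i. obj F (obj D i)" "\<lambda>i j. fm (arr D (i, j))"
      "\<lambda>i. fm (c i)" "obj F X" by (rule CX)
  note transfer = stage_transfer[OF hb spans U MX GX cX]
  show "fm y s a = fm y s b"
    if s: "s \<in> sorts \<Sigma>" and a: "a \<in> carr (obj F U) s" and b: "b \<in> carr (obj F U) s"
      and eq: "fm x s a = fm x s b"
  proof -
    obtain i1 a1 where i1: "i1 \<in> PU" "a1 \<in> carr (obj F (obj DU i1)) s" "a = fm (cU i1) s a1"
      using FU.surj[OF s a] by blast
    obtain i2 b2 where i2: "i2 \<in> PU" "b2 \<in> carr (obj F (obj DU i2)) s" "b = fm (cU i2) s b2"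
      using FU.surj[OF s b] by blast
    obtain i where i: "i \<in> PU" "(i1, i) \<in> rU" "(i2, i) \<in> rU" using U.upper2[OF i1(1) i2(1)] .
    define a0 where "a0 = fm (arr DU (i1, i)) s a1"
    define b0 where "b0 = fm (arr DU (i2, i)) s b2"
    have a0: "a0 \<in> carr (obj F (obj DU i)) s" "a = fm (cU i) s a0"
      using FU.map_carr[OF i(2) s i1(2)] FU.q_comp[OF i(2) s i1(2)] i1(3) by (simp_all add: a0_def)
    have b0: "b0 \<in> carr (obj F (obj DU i)) s" "b = fm (cU i) s b0"
      using FU.map_carr[OF i(3) s i2(2)] FU.q_comp[OF i(3) s i2(2)] i2(3) by (simp_all add: b0_def)
    obtain j m where j: "j \<in> P" and m: "m \<in> hom A (obj DU i) (obj D j)"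
      and xm: "Cmp A x (cU i) = Cmp A (c j) m"
      and lift: "\<And>k. (j, k) \<in> r \<Longrightarrow>
        \<exists>n\<in>hom A (obj D k) Y. Cmp A y (cU i) = Cmp A n (Cmp A (arr D (j, k)) m)"
      using transfer[OF bspec[OF GU i(1)] U.c_hom[OF i(1)]] by blast
    have xc: "fm x s (fm (cU i) s z) = fm (c j) s (fm m s z)" if "z \<in> carr (obj F (obj DU i)) s" for z
      using fm_comp[OF U.c_hom[OF i(1)] x s that] fm_comp[OF m X.c_hom[OF j] s that] xm by simp
    have ma: "fm m s a0 \<in> carr (obj F (obj D j)) s" and mb: "fm m s b0 \<in> carr (obj F (obj D j)) s"
      using hom_carr[OF F_arr(2)[OF m] s] a0(1) b0(1) by blast+
    have "fm (c j) s (fm m s a0) = fm (c j) s (fm m s b0)"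
      using eq xc a0 b0 by simp
    then obtain k where k: "(j, k) \<in> r"
      "fm (arr D (j, k)) s (fm m s a0) = fm (arr D (j, k)) s (fm m s b0)"
      using FX.eq_reflect[OF j s ma mb] by blast
    obtain n where n: "n \<in> hom A (obj D k) Y" "Cmp A y (cU i) = Cmp A n (Cmp A (arr D (j, k)) m)"
      using lift[OF k(1)] by blast
    have yc: "fm y s (fm (cU i) s z) = fm n s (fm (arr D (j, k)) s (fm m s z))"
      if "z \<in> carr (obj F (obj DU i)) s" for z
      using fm_comp[OF U.c_hom[OF i(1)] y s that] fm_comp[OF cmp[OF m X.D_arr[OF k(1)]] n(1) s that]
        fm_comp[OF m X.D_arr[OF k(1)] s that] n(2) by simp
    show ?thesis using yc a0 b0 k(2) by simp
  qed
  show "rmap \<Sigma> R (fm y) a' \<in> rint (obj F Y) R"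
    if R: "R \<in> rels \<Sigma>" and a: "a' \<in> rtup \<Sigma> R (obj F U)" and xa: "rmap \<Sigma> R (fm x) a' \<in> rint (obj F X) R"
  proof -
    note rs = rsorts[OF R]
    obtain i t where i: "i \<in> PU" and t: "t \<in> rtup \<Sigma> R (obj F (obj DU i))" and at: "a' = rmap \<Sigma> R (fm (cU i)) t"
      using FU.N_tuple_stage[OF rargs_lam[OF R] rs a] .
    obtain j m where j: "j \<in> P" and m: "m \<in> hom A (obj DU i) (obj D j)"
      and xm: "Cmp A x (cU i) = Cmp A (c j) m"
      and lift: "\<And>k. (j, k) \<in> r \<Longrightarrow>
        \<exists>n\<in>hom A (obj D k) Y. Cmp A y (cU i) = Cmp A n (Cmp A (arr D (j, k)) m)"
      using transfer[OF bspec[OF GU i] U.c_hom[OF i]] by blast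
    have mt: "rmap \<Sigma> R (fm m) t \<in> rtup \<Sigma> R (obj F (obj D j))" using hom_tuples[OF F_arr(2)[OF m] rs t] .
    have "rmap \<Sigma> R (fm (c j)) (rmap \<Sigma> R (fm m) t) \<in> rint (obj F X) R"
      using fm_tmap_comp[OF U.c_hom[OF i] x rs t] fm_tmap_comp[OF m X.c_hom[OF j] rs t] xm xa at by simp
    then obtain k where k: "(j, k) \<in> r"
      "rmap \<Sigma> R (fm (arr D (j, k))) (rmap \<Sigma> R (fm m) t) \<in> rint (obj F (obj D k)) R"
      using FX.rel_reflect[OF j R mt] by blast
    obtain n where n: "n \<in> hom A (obj D k) Y" "Cmp A y (cU i) = Cmp A n (Cmp A (arr D (j, k)) m)"
      using lift[OF k(1)] by blast
    have "rmap \<Sigma> R (fm n) (rmap \<Sigma> R (fm (arr D (j, k))) (rmap \<Sigma> R (fm m) t)) \<in> rint (obj F Y) R"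
      using hom_rint[OF F_arr(2)[OF n(1)] R k(2)] .
    then show ?thesis
      using fm_tmap_comp[OF U.c_hom[OF i] y rs t] fm_tmap_comp[OF cmp[OF m X.D_arr[OF k(1)]] n(1) rs t]
        fm_tmap_comp[OF m X.D_arr[OF k(1)] rs t] n(2) at by simp
  qed
qed

definition image_span where
  "image_span X Y p p' \<longleftrightarrow> (\<exists>W e1 e2. p' = (W, (W, e1, obj F X), (W, e2, obj F Y)) \<and>
    common_image (obj F (fst p)) (obj F X) (fm (fst (snd p))) (obj F Y) (fm (snd (snd p))) W e1 e2)"

lemma image_span_swap: "image_span X Y p p' \<Longrightarrow> image_span Y X (swap p) (swap p')"
  unfolding image_span_def using common_image_sym by (cases p) fastforce

lemma image_span_is_span:
  assumes "X \<in> Ob A" and "Y \<in> Ob A" and "image_span X Y p p'"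
  shows "is_span \<M> (obj F X) (obj F Y) p'"
  using assms F_model injective_mono
  by (auto simp: image_span_def common_image_def is_span_def Mod_hom embedding_def)

text \<open>
  The back condition carries coincidences from \<open>F X\<close> to \<open>F Y\<close>, and applied to the reversed spans it
  carries them from \<open>F Y\<close> to \<open>F X\<close>.
\<close>

lemma ex_image_span:
  assumes hb: "has_back \<theta> lam A X S" "has_back \<theta> lam A Y (swap ` S)"
    and spans: "\<forall>p\<in>S. is_span A X Y p" and p: "p \<in> S"
  shows "\<exists>p'. image_span X Y p p'"
proof -
  obtain U x y where p_eq: "p = (U, x, y)" by (cases p)
  have x: "x \<in> hom A U X" and y: "y \<in> hom A U Y" using bspec[OF spans p] by (simp_all add: p_eq is_span_def)
  have U: "(U, x, y) \<in> S" and U': "(U, y, x) \<in> swap ` S" using p p_eq by force+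
  note spans' = spans_swap[OF spans]
  have "\<exists>W e1 e2. common_image (obj F U) (obj F X) (fm x) (obj F Y) (fm y) W e1 e2"
  proof (rule ex_common_image)
    show "struc (obj F U)" "obj F X \<in> Ob \<M>" using F_struc F_model hom_Ob[OF x] by blast+
    show "homo (obj F U) (obj F X) (fm x)" "homo (obj F U) (obj F Y) (fm y)"
      using F_arr(2)[OF x] F_arr(2)[OF y] .
    show "fm x s a = fm x s b \<longleftrightarrow> fm y s a = fm y s b"
      if "s \<in> sorts \<Sigma>" "a \<in> carr (obj F U) s" "b \<in> carr (obj F U) s" for s a b
      using kernel_transfer[OF hb(1) spans U that] kernel_transfer[OF hb(2) spans' U' that] by blast
    show "rmap \<Sigma> R (fm x) a \<in> rint (obj F X) R \<longleftrightarrow> rmap \<Sigma> R (fm y) a \<in> rint (obj F Y) R"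
      if "R \<in> rels \<Sigma>" "a \<in> rtup \<Sigma> R (obj F U)" for R a
      using relation_transfer[OF hb(1) spans U that] relation_transfer[OF hb(2) spans' U' that] by blast
  qed
  then show ?thesis unfolding image_span_def p_eq by auto
qed

text \<open>
  The values of \<open>g\<close> lie in the image of \<open>F\<close> of a generated subobject of \<open>X\<close>.  A span in \<open>A\<close> whose apex
  contains this subobject has an image that contains these values, and \<open>g\<close> factors through it by
  \<open>embedding_factor\<close>.
\<close>

lemma back_images:
  assumes X: "X \<in> Ob A" and Y: "Y \<in> Ob A"
    and hb: "has_back \<theta> lam A X S" and spans: "\<forall>p\<in>S. is_span A X Y p"
    and \<phi>: "\<forall>p\<in>S. image_span X Y p (\<phi> p)"
  shows "has_back \<theta> lam \<M> (obj F X) (\<phi> ` S)"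
proof -
  have "\<exists>(V', f1', f2')\<in>\<phi> ` S. \<exists>s\<in>hom \<M> K V'. \<exists>w\<in>hom \<M> W V'.
      Cmp \<M> f1' s = g \<and> Cmp \<M> f1' w = f1 \<and> Cmp \<M> f2' w = f2"
    if p: "(W, f1, f2) \<in> \<phi> ` S" and K: "generated \<theta> lam \<M> K" and g: "g \<in> hom \<M> K (obj F X)" for W f1 f2 K g
  proof -
    obtain U x y where U: "(U, x, y) \<in> S" and W: "(W, f1, f2) = \<phi> (U, x, y)" using p by auto
    obtain e1 e2 where f1: "f1 = (W, e1, obj F X)" and f2: "f2 = (W, e2, obj F Y)"
      and ci: "common_image (obj F U) (obj F X) (fm x) (obj F Y) (fm y) W e1 e2"
      using bspec[OF \<phi> U] unfolding W[symmetric] image_span_def by auto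
    obtain e where WM: "W \<in> Ob \<M>" and emb1: "embedding \<Sigma> W (obj F X) e1" and emb2: "embedding \<Sigma> W (obj F Y) e2"
      and e: "\<And>s. s \<in> sorts \<Sigma> \<Longrightarrow> e s ` carr (obj F U) s = carr W s"
      "\<And>s a. s \<in> sorts \<Sigma> \<Longrightarrow> a \<in> carr (obj F U) s \<Longrightarrow> e1 s (e s a) = fm x s a \<and> e2 s (e s a) = fm y s a"
      using ci unfolding common_image_def by blast
    obtain g' where g': "g = (K, g', obj F X)" "homo K (obj F X) g'" and KM: "K \<in> Ob \<M>"
      using g by (auto simp: Mod_hom)
    obtain P r D c where MX: "mono_diagram A lam P r \<theta> D X c"
      and GX: "\<forall>i\<in>P. generated \<theta> lam A (obj D i)" and cX: "\<forall>i\<in>P. mono_in A (c i)"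
      and CX: "concrete_colimit \<theta> lam \<kappa> \<Sigma> T P r (\<lambda>i. obj F (obj D i)) (\<lambda>i j. fm (arr D (i, j)))
        (\<lambda>i. fm (c i)) (obj F X)"
      using presentation[OF X] by metis
    interpret X: mono_diagram A lam P r \<theta> D X c by (rule MX)
    obtain i where i: "i \<in> P"
      and range: "\<And>s. s \<in> sorts \<Sigma> \<Longrightarrow> g' s ` carr K s \<subseteq> fm (c i) s ` carr (obj F (obj D i)) s"
      using concrete_colimit.generated_range[OF CX K g'(2)] by blast
    obtain V x' y' s w where V: "(V, x', y') \<in> S" and s: "s \<in> hom A (obj D i) V" and w: "w \<in> hom A U V"
      and eqs: "Cmp A x' s = c i" "Cmp A x' w = x" "Cmp A y' w = y"
      using hb U bspec[OF GX i] X.c_hom[OF i] bspec[OF cX i] unfolding has_back_def by blast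
    have x': "x' \<in> hom A V X" and y': "y' \<in> hom A V Y" using bspec[OF spans V] by (simp_all add: is_span_def)
    obtain V' e1' e2' where V': "\<phi> (V, x', y') = (V', (V', e1', obj F X), (V', e2', obj F Y))"
      and ci': "common_image (obj F V) (obj F X) (fm x') (obj F Y) (fm y') V' e1' e2'"
      using bspec[OF \<phi> V] unfolding image_span_def by auto
    obtain e' where VM: "V' \<in> Ob \<M>" and emb1': "embedding \<Sigma> V' (obj F X) e1'"
      and emb2': "embedding \<Sigma> V' (obj F Y) e2'"
      and e': "\<And>s. s \<in> sorts \<Sigma> \<Longrightarrow> e' s ` carr (obj F V) s = carr V' s"
      "\<And>s a. s \<in> sorts \<Sigma> \<Longrightarrow> a \<in> carr (obj F V) s \<Longrightarrow> e1' s (e' s a) = fm x' s a \<and> e2' s (e' s a) = fm y' s a"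
      using ci' unfolding common_image_def by blast
    note st = model_struc[OF WM] model_struc[OF KM] model_struc[OF VM]
    have x'_range: "fm x' t z \<in> e1' t ` carr V' t" if "t \<in> sorts \<Sigma>" "z \<in> carr (obj F V) t" for t z
      using e'(1)[OF that(1)] e'(2)[OF that] that(2) by (metis imageI)
    have "g' t a \<in> e1' t ` carr V' t" if t: "t \<in> sorts \<Sigma>" and a: "a \<in> carr K t" for t a
    proof -
      obtain b where b: "b \<in> carr (obj F (obj D i)) t" "g' t a = fm (c i) t b" using range[OF t] a by blast
      then have "g' t a = fm x' t (fm s t b)" using fm_comp[OF s x' t b(1)] eqs(1) by simp
      then show ?thesis using x'_range[OF t] hom_carr[OF F_arr(2)[OF s] t b(1)] by simp
    qed
    then obtain k where k: "homo K V' k" "\<And>t a. t \<in> sorts \<Sigma> \<Longrightarrow> a \<in> carr K t \<Longrightarrow> e1' t (k t a) = g' t a"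
      using embedding_factor[OF st(3,2) emb1' g'(2)] by blast
    have wx: "fm x t a = fm x' t (fm w t a)" "fm y t a = fm y' t (fm w t a)" "fm w t a \<in> carr (obj F V) t"
      if "t \<in> sorts \<Sigma>" "a \<in> carr (obj F U) t" for t a
      using fm_comp[OF w x' that] fm_comp[OF w y' that] eqs hom_carr[OF F_arr(2)[OF w] that] by simp_all
    have "e1 t z \<in> e1' t ` carr V' t" if t: "t \<in> sorts \<Sigma>" and z: "z \<in> carr W t" for t z
    proof -
      obtain a where a: "a \<in> carr (obj F U) t" "z = e t a" using e(1)[OF t] z by blast
      then show ?thesis using e(2)[OF t a(1)] wx[OF t a(1)] x'_range[OF t] by simp
    qed
    then obtain l where l: "homo W V' l" "\<And>t z. t \<in> sorts \<Sigma> \<Longrightarrow> z \<in> carr W t \<Longrightarrow> e1' t (l t z) = e1 t z"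
      using embedding_factor[OF st(3,1) emb1' embedding_hom[OF emb1]] by blast
    \<comment> \<open>compatibility with the right legs is tested on elements \<open>e t a\<close>, where it holds in \<open>A\<close>\<close>
    have l2: "e2' t (l t z) = e2 t z" if t: "t \<in> sorts \<Sigma>" and z: "z \<in> carr W t" for t z
    proof -
      obtain a where a: "a \<in> carr (obj F U) t" "z = e t a" using e(1)[OF t] z by blast
      note wa = wx[OF t a(1)]
      have "e1' t (l t z) = e1' t (e' t (fm w t a))"
        using l(2)[OF t z] e(2)[OF t a(1)] a(2) wa e'(2)[OF t wa(3)] by simp
      then have "l t z = e' t (fm w t a)"
        using embedding_inj[OF emb1' t hom_carr[OF l(1) t z]] e'(1)[OF t] wa(3) by blast
      then show ?thesis using e(2)[OF t a(1)] a(2) wa e'(2)[OF t wa(3)] by simp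
    qed
    have "(V', (V', e1', obj F X), (V', e2', obj F Y)) \<in> \<phi> ` S" using V V' by force
    moreover have "(K, k, V') \<in> hom \<M> K V'" "(W, l, V') \<in> hom \<M> W V'"
      using KM VM WM k(1) l(1) by (auto simp: Mod_hom)
    moreover have "Cmp \<M> (V', e1', obj F X) (K, k, V') = g"
      unfolding g'(1) using Mod_cmp_eqI[OF st(2) k(1) embedding_hom[OF emb1'] g'(2) k(2)] .
    moreover have "Cmp \<M> (V', e1', obj F X) (W, l, V') = f1"
      unfolding f1 using Mod_cmp_eqI[OF st(1) l(1) embedding_hom[OF emb1'] embedding_hom[OF emb1] l(2)] .
    moreover have "Cmp \<M> (V', e2', obj F Y) (W, l, V') = f2"
      unfolding f2 using Mod_cmp_eqI[OF st(1) l(1) embedding_hom[OF emb2'] embedding_hom[OF emb2] l2] .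
    ultimately show ?thesis by blast
  qed
  then show ?thesis unfolding has_back_def by blast
qed

theorem lam_equivalent_image:
  assumes X: "X \<in> Ob A" and Y: "Y \<in> Ob A" and eq: "lam_equivalent \<theta> lam A X Y"
  shows "lam_equivalent \<theta> lam \<M> (obj F X) (obj F Y)"
proof -
  obtain S where small: "small \<theta> S" and spans: "\<forall>p\<in>S. is_span A X Y p" and ne: "S \<noteq> {}"
    and hb: "has_back \<theta> lam A X S" "has_back \<theta> lam A Y (swap ` S)"
    using eq unfolding lam_equivalent_def dense_spans_iff by blast
  obtain \<phi> where \<phi>: "\<forall>p\<in>S. image_span X Y p (\<phi> p)"
    using ex_image_span[OF hb spans] by metis
  have "dense_spans \<theta> lam \<M> (obj F X) (obj F Y) (\<phi> ` S)"
    unfolding dense_spans_iff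
  proof (intro conjI ballI)
    show "small \<theta> (\<phi> ` S)"
      using small card_of_image ordLeq_ordLess_trans unfolding small_def by blast
    show "is_span \<M> (obj F X) (obj F Y) p'" if "p' \<in> \<phi> ` S" for p'
      using that image_span_is_span[OF X Y] \<phi> by blast
    show "\<phi> ` S \<noteq> {}" using ne by blast
    show "has_back \<theta> lam \<M> (obj F X) (\<phi> ` S)" using back_images[OF X Y hb(1) spans \<phi>] .
    have "has_back \<theta> lam \<M> (obj F Y) ((\<lambda>p. swap (\<phi> (swap p))) ` swap ` S)"
    proof (rule back_images[OF Y X hb(2)])
      show "\<forall>p\<in>swap ` S. is_span A Y X p" by (rule spans_swap[OF spans])
      show "\<forall>p\<in>swap ` S. image_span Y X p (swap (\<phi> (swap p)))"
        using image_span_swap[OF bspec[OF \<phi>]] by auto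
    qed
    then show "has_back \<theta> lam \<M> (obj F Y) (swap ` \<phi> ` S)" by (simp add: image_image)
  qed
  then show ?thesis using F_model X Y unfolding lam_equivalent_def by blast
qed

end

theorem theorem2p18:
  fixes \<theta> :: "'u rel" and lam :: "'l rel" and \<kappa> :: "'k rel"
    and A :: "('o, 'm) cat"
    and \<Sigma> :: "('s, 'f, 'r, 'u) lang" and T :: "('s, 'f, 'r, 'u) sentence set"
    and F :: "('o, 'm, ('s, 'f, 'r, 'u) struct,
               ('s, 'f, 'r, 'u) struct \<times> ('s \<Rightarrow> 'u \<Rightarrow> 'u) \<times> ('s, 'f, 'r, 'u) struct) fctr"
    and X Y :: 'o
  assumes "Cinfinite \<theta>" and "regularCard \<theta>" and "lam <o \<theta>"
    and "Cinfinite lam" and "regularCard lam"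
    and "Cinfinite \<kappa>" and "\<kappa> \<le>o lam"
    and "mono_generated \<theta> lam A"
    and "language \<theta> \<kappa> \<Sigma>" and "basic_universal_theory \<theta> lam \<kappa> \<Sigma> T"
    and "is_functor A (Mod \<theta> \<Sigma> T) F"
    and "directed_mono_colims_to_colims \<theta> lam A (Mod \<theta> \<Sigma> T) F"
    and "X \<in> Ob A" and "Y \<in> Ob A"
    and "lam_equivalent \<theta> lam A X Y"
  shows "lam_equivalent \<theta> lam (Mod \<theta> \<Sigma> T) (obj F X) (obj F Y)"
proof -
  interpret category A using assms by (simp add: mono_generated_def)
  interpret model_functor \<theta> lam \<kappa> \<Sigma> T A F
    by unfold_locales (use assms in blast)+
  show ?thesis by (rule lam_equivalent_image) (use assms in blast)+
qed

end
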